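(* Let $d\ge 2$. The prime ideal $\mathcal{I}(\mathcal{K}^{\mathrm{IG}}_d)\subseteq\mathbb{C}[\kappa_1,\ldots,\kappa_d]$ of the $d$th inverse Gaussian cumulant variety $\mathcal{K}^{\mathrm{IG}}_d\subseteq\mathbb{C}^d$ is generated by the $\binom{d-1}{2}$ quadrics given by the $2$-minors of the $2\times(d-1)$ matrix $$K_d=\begin{pmatrix} \kappa_1 & 3\kappa_2 & 5\kappa_3 & \cdots & (2d-3)\kappa_{d-1}\\ \kappa_2 & \kappa_3 & \kappa_4 & \cdots & \kappa_d \end{pmatrix}.$$ Furthermore, $\mathcal{I}(\mathcal{K}^{\mathrm{IG}}_d)$ is Cohen--Macaulay, its degree is $d-1$, and it has a Gröbner basis given by the $2$-minors of $K_d$ with respect to any antidiagonal term order.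
   Context: The cumulants $\kappa_r$ of a distribution are defined by $\log M(t)=\sum_{r\ge1}\kappa_r t^r/r!$, where $M(t)$ is the moment generating function. For the inverse Gaussian distribution with parameters $\mu,\lambda$ they are $\kappa_r=\frac{(2r-3)!!\,\mu^{2r-1}}{\lambda^{r-1}}$ for $r\ge 1$ (with $(-1)!!=1$). The cumulant variety $\mathcal{K}^{\mathrm{IG}}_d\subseteq\mathbb{C}^d$ is the Zariski closure of the set of points $(\kappa_1(\mu,\lambda),\ldots,\kappa_d(\mu,\lambda))$ with $\mu\in\mathbb{C}$, $\lambda\in\mathbb{C}\setminus\{0\}$. $\mathcal{I}(\cdot)$ denotes the vanishing ideal. An ideal $I$ of a polynomial ring $S$ is called Cohen--Macaulay if $S/I$ is a Cohen--Macaulay ring; the degree of a homogeneous ideal $I$ is the degree (multiplicity) of the standard graded ring $S/I$. An antidiagonal term order is a monomial order for which the initial monomial of each $2$-minor of $K_d$ is (up to a scalar) the product of the entries on its antidiagonal, i.e. for columns $i<j$, of the entries in positions $(2,i)$ and $(1,j)$. *)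

theory Defs
  imports
    "HOL-Library.Poly_Mapping"
    "HOL-Library.Extended_Nat"
    "HOL-Library.FuncSet"
    "HOL-Computational_Algebra.Polynomial"
    "HOL-Algebra.Ring_Divisibility"
    "HOL-Algebra.Embedded_Algebras"
begin

section \<open>The polynomial ring in the variables 1, ..., d and affine space\<close>

text \<open>A polynomial is a finitely supported map from monomials (exponent vectors) to coefficients;
  the product of \<^typ>\<open>(nat \<Rightarrow>\<^sub>0 nat) \<Rightarrow>\<^sub>0 complex\<close> is the convolution product of polynomials.
  Addition of exponent vectors is multiplication of monomials.\<close>

type_synonym monomial = "nat \<Rightarrow>\<^sub>0 nat"
type_synonym cpoly = "monomial \<Rightarrow>\<^sub>0 complex"

definition const_poly :: "complex \<Rightarrow> cpoly" where
  "const_poly c = Poly_Mapping.single 0 c"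

definition var :: "nat \<Rightarrow> cpoly" where
  "var i = Poly_Mapping.single (Poly_Mapping.single i 1) 1"

definition monomials :: "nat \<Rightarrow> monomial set" where
  "monomials d = {m. Poly_Mapping.keys m \<subseteq> {1..d}}"

definition poly_ring :: "nat \<Rightarrow> cpoly ring" where
  "poly_ring d = \<lparr>carrier = {p. Poly_Mapping.keys p \<subseteq> monomials d},
     mult = (*), one = 1, zero = 0, add = (+)\<rparr>"

definition eval_poly :: "(nat \<Rightarrow> complex) \<Rightarrow> cpoly \<Rightarrow> complex" where
  "eval_poly x p = (\<Sum>m\<in>Poly_Mapping.keys p.
     Poly_Mapping.lookup p m * (\<Prod>i\<in>Poly_Mapping.keys m. x i ^ Poly_Mapping.lookup m i))"

definition affine_space :: "nat \<Rightarrow> (nat \<Rightarrow> complex) set" where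
  "affine_space d = ({1..d} \<rightarrow>\<^sub>E UNIV)"

definition algebraic_set :: "nat \<Rightarrow> (nat \<Rightarrow> complex) set \<Rightarrow> bool" where
  "algebraic_set d V \<longleftrightarrow>
     (\<exists>F \<subseteq> carrier (poly_ring d). V = {x \<in> affine_space d. \<forall>f\<in>F. eval_poly x f = 0})"

definition zariski_closure :: "nat \<Rightarrow> (nat \<Rightarrow> complex) set \<Rightarrow> (nat \<Rightarrow> complex) set" where
  "zariski_closure d X = \<Inter>{V. algebraic_set d V \<and> X \<subseteq> V}"

definition vanishing_ideal :: "nat \<Rightarrow> (nat \<Rightarrow> complex) set \<Rightarrow> cpoly set" where
  "vanishing_ideal d V = {f \<in> carrier (poly_ring d). \<forall>x\<in>V. eval_poly x f = 0}"


section \<open>The inverse Gaussian cumulant variety\<close>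

text \<open>The product is the double factorial $(2r-3)!! = 1 \cdot 3 \cdots (2r-3)$; it is empty,
  hence 1, for $r = 1$.\<close>

definition ig_cumulant :: "complex \<Rightarrow> complex \<Rightarrow> nat \<Rightarrow> complex" where
  "ig_cumulant mu lam r = of_nat (\<Prod>i\<in>{1..<r}. 2 * i - 1) * mu ^ (2 * r - 1) / lam ^ (r - 1)"

definition ig_cumulant_variety :: "nat \<Rightarrow> (nat \<Rightarrow> complex) set" where
  "ig_cumulant_variety d =
     zariski_closure d {(\<lambda>r\<in>{1..d}. ig_cumulant mu lam r) | mu lam. lam \<noteq> 0}"

text \<open>Rows 1, 2 and columns 1, ..., d - 1; the entries themselves do not depend on d.\<close>

definition K_entry :: "nat \<Rightarrow> nat \<Rightarrow> cpoly" where
  "K_entry i j = (if i = 1 then const_poly (of_nat (2 * j - 1)) * var j else var (j + 1))"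

definition K_minor :: "nat \<Rightarrow> nat \<Rightarrow> cpoly" where
  "K_minor i j = K_entry 1 i * K_entry 2 j - K_entry 1 j * K_entry 2 i"

definition K_minors :: "nat \<Rightarrow> cpoly set" where
  "K_minors d = {K_minor i j | i j. 1 \<le> i \<and> i < j \<and> j \<le> d - 1}"


section \<open>Grading and degree\<close>

definition homogeneous :: "nat \<Rightarrow> cpoly \<Rightarrow> bool" where
  "homogeneous n p \<longleftrightarrow>
     (\<forall>m\<in>Poly_Mapping.keys p. (\<Sum>i\<in>Poly_Mapping.keys m. Poly_Mapping.lookup m i) = n)"

definition quadric :: "cpoly \<Rightarrow> bool" where
  "quadric p \<longleftrightarrow> p \<noteq> 0 \<and> homogeneous 2 p"

text \<open>The dimension over the field of complex numbers (embedded as constants) of the degree n part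
  of S/I, for a homogeneous ideal I of S.\<close>

definition hilbert_function :: "nat \<Rightarrow> cpoly set \<Rightarrow> nat \<Rightarrow> nat" where
  "hilbert_function d I n =
     ring.dim (poly_ring d Quot I)
       ((\<lambda>c. I +>\<^bsub>poly_ring d\<^esub> const_poly c) ` UNIV)
       ((\<lambda>p. I +>\<^bsub>poly_ring d\<^esub> p) ` {p \<in> carrier (poly_ring d). homogeneous n p})"

definition hilbert_polynomial :: "nat \<Rightarrow> cpoly set \<Rightarrow> rat poly" where
  "hilbert_polynomial d I =
     (THE P. \<forall>\<^sub>F n in sequentially. of_nat (hilbert_function d I n) = poly P (of_nat n))"

text \<open>The degree (multiplicity) of S/I: with $e = \dim S/I$, it is $(e-1)!$ times the leading
  coefficient of the Hilbert polynomial, whose degree is $e-1$; if $e = 0$ (the Hilbert polynomial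
  vanishes), it is the length of S/I.\<close>

definition ideal_degree :: "nat \<Rightarrow> cpoly set \<Rightarrow> rat" where
  "ideal_degree d I =
     (if hilbert_polynomial d I = 0
      then of_nat (\<Sum>n | hilbert_function d I n \<noteq> 0. hilbert_function d I n)
      else fact (degree (hilbert_polynomial d I)) * lead_coeff (hilbert_polynomial d I))"


section \<open>Cohen--Macaulay rings\<close>

text \<open>We follow Eisenbud (Commutative Algebra with a View Toward Algebraic Geometry, Section 18.2):
  a Noetherian commutative ring is Cohen--Macaulay if the depth of every maximal ideal P (the maximal
  length of a regular sequence in P) equals its codimension (the maximal length of a chain of prime
  ideals descending from P).\<close>

definition regular_sequence :: "('a, 'b) ring_scheme \<Rightarrow> 'a list \<Rightarrow> bool" where
  "regular_sequence R xs \<longleftrightarrow>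
     set xs \<subseteq> carrier R \<and>
     Idl\<^bsub>R\<^esub> (set xs) \<noteq> carrier R \<and>
     (\<forall>i < length xs. \<forall>r \<in> carrier R.
        xs ! i \<otimes>\<^bsub>R\<^esub> r \<in> Idl\<^bsub>R\<^esub> (set (take i xs)) \<longrightarrow> r \<in> Idl\<^bsub>R\<^esub> (set (take i xs)))"

definition ideal_depth :: "('a, 'b) ring_scheme \<Rightarrow> 'a set \<Rightarrow> enat" where
  "ideal_depth R P = Sup {enat (length xs) | xs. regular_sequence R xs \<and> set xs \<subseteq> P}"

definition prime_codim :: "('a, 'b) ring_scheme \<Rightarrow> 'a set \<Rightarrow> enat" where
  "prime_codim R P = Sup {enat n | n. \<exists>Q :: nat \<Rightarrow> 'a set.
     (\<forall>i\<le>n. primeideal (Q i) R \<and> Q i \<subseteq> P) \<and> (\<forall>i<n. Q i \<subset> Q (Suc i))}"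

definition cohen_macaulay_ring :: "('a, 'b) ring_scheme \<Rightarrow> bool" where
  "cohen_macaulay_ring R \<longleftrightarrow>
     cring R \<and> noetherian_ring R \<and>
     (\<forall>P. maximalideal P R \<longrightarrow> ideal_depth R P = prime_codim R P)"

definition cohen_macaulay_ideal :: "('a, 'b) ring_scheme \<Rightarrow> 'a set \<Rightarrow> bool" where
  "cohen_macaulay_ideal S I \<longleftrightarrow> ideal I S \<and> cohen_macaulay_ring (S Quot I)"


section \<open>Groebner bases\<close>

text \<open>A term order is given by its relation ``less than or equal'' on the monomials in the
  variables 1, ..., d.\<close>

definition monomial_order :: "nat \<Rightarrow> monomial rel \<Rightarrow> bool" where
  "monomial_order d ord \<longleftrightarrow>
     linear_order_on (monomials d) ord \<and>
     (\<forall>m \<in> monomials d. (0, m) \<in> ord) \<and>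
     (\<forall>s t u. (s, t) \<in> ord \<longrightarrow> u \<in> monomials d \<longrightarrow> (s + u, t + u) \<in> ord)"

definition initial_monomial :: "monomial rel \<Rightarrow> cpoly \<Rightarrow> monomial" where
  "initial_monomial ord f =
     (THE m. m \<in> Poly_Mapping.keys f \<and> (\<forall>m' \<in> Poly_Mapping.keys f. (m', m) \<in> ord))"

definition initial_ideal :: "nat \<Rightarrow> monomial rel \<Rightarrow> cpoly set \<Rightarrow> cpoly set" where
  "initial_ideal d ord F =
     Idl\<^bsub>poly_ring d\<^esub> ((\<lambda>f. Poly_Mapping.single (initial_monomial ord f) 1) ` (F - {0}))"

definition groebner_basis :: "nat \<Rightarrow> monomial rel \<Rightarrow> cpoly set \<Rightarrow> cpoly set \<Rightarrow> bool" where
  "groebner_basis d ord G I \<longleftrightarrow>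
     finite G \<and> G \<subseteq> I \<and> initial_ideal d ord G = initial_ideal d ord I"

definition antidiagonal_term_order :: "nat \<Rightarrow> monomial rel \<Rightarrow> bool" where
  "antidiagonal_term_order d ord \<longleftrightarrow>
     monomial_order d ord \<and>
     (\<forall>i j. 1 \<le> i \<and> i < j \<and> j \<le> d - 1 \<longrightarrow>
        (\<exists>c. c \<noteq> 0 \<and>
           K_entry 2 i * K_entry 1 j
             = Poly_Mapping.single (initial_monomial ord (K_minor i j)) c))"

end

theory Submission
  imports Defs
    "HOL-Analysis.Continuum_Not_Denumerable"
    "HOL-Computational_Algebra.Fundamental_Theorem_Algebra"
begin

text \<open>Substituting \<open>s = \<mu>\<close> and \<open>t = \<mu>\<^sup>2 / \<lambda>\<close> turns the cumulants into \<open>\<kappa>\<^sub>r = (2r-3)!! s t\<^bsup>r-1\<^esup>\<close>,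
  so the variety is the cone over a rescaled rational normal curve and its ideal is the kernel of a
  homomorphism to polynomials in \<open>s\<close> and \<open>t\<close> that is homogeneous for the bidegree. Up to
  scalars, the minors identify \<open>\<kappa>\<^bsub>i+1\<^esub> \<kappa>\<^sub>j\<close> with \<open>\<kappa>\<^sub>i \<kappa>\<^bsub>j+1\<^esub>\<close> for \<open>i < j\<close>; applying
  this repeatedly leads from any monomial to the unique monomial of its bidegree that has degree at most 1 in
  \<open>\<kappa>\<^sub>2, \<dots>, \<kappa>\<^bsub>d-1\<^esub>\<close>. These standard monomials give the generators, the Groebner
  basis and the Hilbert function \<open>(d-1) n + 1\<close>. The quotient is free over
  \<open>\<complex>[\<kappa>\<^sub>1, \<kappa>\<^sub>d]\<close>, so that \<open>\<kappa>\<^sub>1 - a, \<kappa>\<^sub>d - b\<close> is a regular sequence at the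
  maximal ideal of a point with these coordinates. Depth never exceeds codimension, and quadratic growth bounds the length of
  prime chains by 2.\<close>

text \<open>The definition of Cohen-Macaulay ranges over all maximal ideals, not only the
  homogeneous one. The equality of depth and codimension is therefore squeezed, 2 <= depth <=
  codimension <= 2, without dimension theory or localization. The lower bound needs constants a and
  b with kappa_1 - a and kappa_d - b in the given maximal ideal; they exist because \<complex> is
  uncountable and algebraically closed. The middle inequality builds a chain of primes from a
  regular sequence. The upper bound counts dimensions in the filtration by degree, because the
  primes of a chain need not be homogeneous. An antidiagonal order is known only through its values
  on the minors, but this is enough: \<open>reduction_to_std\<close> is proved for any suitable
  relation \<open>R\<close>, and is applied both to congruence modulo the minors and to the term
  order itself, so no S-polynomials occur. Ideal membership is always tested by linear functionals
  on the coefficients, one for each bidegree or, after fixing the value of kappa_1, one for each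
  weight. For d = 2 there are no minors, the ideal is zero, and the same arguments apply.\<close>

lemma poly_mapping_eq_sum_single:
  fixes p :: "'a \<Rightarrow>\<^sub>0 'b::comm_monoid_add"
  shows "p = (\<Sum>m\<in>Poly_Mapping.keys p. Poly_Mapping.single m (Poly_Mapping.lookup p m))"
  by (rule poly_mapping_eqI)
    (auto simp: lookup_sum lookup_single when_def in_keys_iff sum.delta')

lemma poly_mapping_additive_induct [consumes 1, case_names zero single add]:
  fixes p :: "'a \<Rightarrow>\<^sub>0 'b::comm_monoid_add"
  assumes "Poly_Mapping.keys p \<subseteq> A" and "P 0"
    and "\<And>m c. m \<in> A \<Longrightarrow> P (Poly_Mapping.single m c)"
    and "\<And>f g. P f \<Longrightarrow> P g \<Longrightarrow> P (f + g)"
  shows "P p"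
proof -
  have "P (\<Sum>m\<in>B. Poly_Mapping.single m (Poly_Mapping.lookup p m))"
    if "finite B" "B \<subseteq> A" for B
    using that by (induction B rule: finite_induct) (auto intro: assms)
  from this[OF finite_keys assms(1)] show ?thesis
    by (simp flip: poly_mapping_eq_sum_single)
qed

text \<open>Common form of evaluation at a point, of the bidegree coefficients
  \<open>bicoeff\<close> and of \<open>slice_coeff\<close>: each is a linear functional given by its
  values on the monomials.\<close>

definition linear_extension :: "('m \<Rightarrow> 'c::comm_semiring_1) \<Rightarrow> ('m \<Rightarrow>\<^sub>0 'c) \<Rightarrow> 'c" where
  "linear_extension w p = (\<Sum>m\<in>Poly_Mapping.keys p. Poly_Mapping.lookup p m * w m)"

lemma linear_extension_add:
  "linear_extension w (p + q) = linear_extension w p + linear_extension w q"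
  unfolding linear_extension_def
  by (rule setsum_keys_plus_distrib) (auto simp: algebra_simps)

lemma linear_extension_0 [simp]: "linear_extension w 0 = 0"
  by (simp add: linear_extension_def)

lemma linear_extension_single [simp]:
  "linear_extension w (Poly_Mapping.single m c) = c * w m"
  by (cases "c = 0") (auto simp: linear_extension_def)

lemma linear_extension_uminus:
  fixes w :: "'m \<Rightarrow> 'c::comm_ring_1"
  shows "linear_extension w (- p) = - linear_extension w p"
  using linear_extension_add[of w p "- p"] by (simp add: eq_neg_iff_add_eq_0 add.commute)

lemma linear_extension_diff:
  fixes w :: "'m \<Rightarrow> 'c::comm_ring_1"
  shows "linear_extension w (p - q) = linear_extension w p - linear_extension w q"
  using linear_extension_add[of w p "- q"] by (simp add: linear_extension_uminus)

lemma linear_extension_sum: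
  "linear_extension w (\<Sum>i\<in>A. f i) = (\<Sum>i\<in>A. linear_extension w (f i))"
  by (induction A rule: infinite_finite_induct) (auto simp: linear_extension_add)

lemma linear_extension_cong:
  assumes "\<And>m. m \<in> Poly_Mapping.keys p \<Longrightarrow> w m = w' m"
  shows "linear_extension w p = linear_extension w' p"
  unfolding linear_extension_def using assms by (auto intro: sum.cong)

lemma linear_extension_single_mult:
  "linear_extension w (Poly_Mapping.single m c * p) = c * linear_extension (\<lambda>m'. w (m + m')) p"
  using subset_UNIV[of "Poly_Mapping.keys p"]
proof (induction p rule: poly_mapping_additive_induct)
  case (add f g)
  then show ?case by (simp add: algebra_simps linear_extension_add)
qed (auto simp: mult_single algebra_simps)

lemma lookup_single_mult:
  fixes p :: "('a::cancel_comm_monoid_add) \<Rightarrow>\<^sub>0 'b::comm_semiring_1"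
  shows "Poly_Mapping.lookup (Poly_Mapping.single u c * p) (u + k) = c * Poly_Mapping.lookup p k"
  using subset_UNIV[of "Poly_Mapping.keys p"]
proof (induction p rule: poly_mapping_additive_induct)
  case (single m a)
  then show ?case by (simp add: mult_single lookup_single when_def)
next
  case (add f g)
  then show ?case by (simp add: algebra_simps lookup_add)
qed simp

lemma keys_single_mult:
  "Poly_Mapping.keys (Poly_Mapping.single u c * p) \<subseteq> (+) u ` Poly_Mapping.keys p"
  using keys_mult[of "Poly_Mapping.single u c" p] by (auto split: if_splits)


subsection \<open>Weights and values of monomials\<close>

text \<open>Used with three weights: 1 gives the degree, i - 1 the exponent of t, and i squared the
  measure for the termination of the reduction.\<close>

definition mweight :: "('a \<Rightarrow> nat) \<Rightarrow> ('a \<Rightarrow>\<^sub>0 nat) \<Rightarrow> nat" where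
  "mweight w m = (\<Sum>i\<in>Poly_Mapping.keys m. Poly_Mapping.lookup m i * w i)"

lemma mweight_add [simp]: "mweight w (m + m') = mweight w m + mweight w m'"
  unfolding mweight_def by (rule setsum_keys_plus_distrib) (auto simp: algebra_simps)

lemma mweight_0 [simp]: "mweight w 0 = 0"
  by (simp add: mweight_def)

lemma mweight_single [simp]: "mweight w (Poly_Mapping.single i k) = k * w i"
  by (cases "k = 0") (auto simp: mweight_def)

lemma mweight_mono:
  assumes "\<And>i. i \<in> Poly_Mapping.keys m \<Longrightarrow> w i \<le> w' i"
  shows "mweight w m \<le> mweight w' m"
  unfolding mweight_def using assms by (auto intro!: sum_mono)

lemma mweight_mult: "mweight (\<lambda>i. c * w i) m = c * mweight w m"
  by (simp add: mweight_def sum_distrib_left algebra_simps)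

definition mdeg :: "monomial \<Rightarrow> nat" where "mdeg = mweight (\<lambda>_. 1)"

lemma mdeg_simps [simp]:
  "mdeg 0 = 0" "mdeg (m + m') = mdeg m + mdeg m'" "mdeg (Poly_Mapping.single i k) = k"
  by (simp_all add: mdeg_def)

lemma homogeneous_iff: "homogeneous n p \<longleftrightarrow> (\<forall>m\<in>Poly_Mapping.keys p. mdeg m = n)"
  by (simp add: homogeneous_def mdeg_def mweight_def)

definition mvalue :: "('a \<Rightarrow> 'c) \<Rightarrow> ('a \<Rightarrow>\<^sub>0 nat) \<Rightarrow> 'c::comm_semiring_1" where
  "mvalue x m = (\<Prod>i\<in>Poly_Mapping.keys m. x i ^ Poly_Mapping.lookup m i)"

lemma mvalue_superset:
  assumes "finite A" "Poly_Mapping.keys m \<subseteq> A"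
  shows "mvalue x m = (\<Prod>i\<in>A. x i ^ Poly_Mapping.lookup m i)"
  unfolding mvalue_def
  by (rule prod.mono_neutral_left) (use assms in \<open>auto simp: in_keys_iff\<close>)

lemma mvalue_add [simp]: "mvalue x (m + m') = mvalue x m * mvalue x m'"
proof -
  let ?A = "Poly_Mapping.keys m \<union> Poly_Mapping.keys m'"
  have "Poly_Mapping.keys (m + m') \<subseteq> ?A" by (rule keys_add)
  then show ?thesis
    by (simp add: mvalue_superset[of ?A] lookup_add power_add prod.distrib)
qed

lemma mvalue_0 [simp]: "mvalue x 0 = 1"
  by (simp add: mvalue_def)

lemma mvalue_single [simp]: "mvalue x (Poly_Mapping.single i k) = x i ^ k"
  by (cases "k = 0") (auto simp: mvalue_def)

lemma mvalue_nonzero: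
  fixes x :: "'a \<Rightarrow> 'c::idom"
  assumes "\<And>i. i \<in> Poly_Mapping.keys m \<Longrightarrow> x i \<noteq> 0"
  shows "mvalue x m \<noteq> 0"
  using assms by (auto simp: mvalue_def)

lemma eval_poly_eq: "eval_poly x = linear_extension (mvalue x)"
  by (simp add: eval_poly_def linear_extension_def mvalue_def fun_eq_iff)


subsection \<open>The polynomial ring\<close>

lemma monomials_0 [simp]: "0 \<in> monomials d"
  by (simp add: monomials_def)

lemma monomials_single [simp]:
  "Poly_Mapping.single i k \<in> monomials d \<longleftrightarrow> k = 0 \<or> i \<in> {1..d}"
  by (auto simp: monomials_def)

lemma monomials_add [simp]: "m + m' \<in> monomials d \<longleftrightarrow> m \<in> monomials d \<and> m' \<in> monomials d"
proof -
  have "Poly_Mapping.keys (m + m') = Poly_Mapping.keys m \<union> Poly_Mapping.keys m'"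
    by (auto simp: in_keys_iff lookup_add)
  then show ?thesis by (simp add: monomials_def)
qed

abbreviation polys :: "nat \<Rightarrow> cpoly set" where "polys d \<equiv> {p. Poly_Mapping.keys p \<subseteq> monomials d}"

lemma poly_ring_simps [simp]:
  "carrier (poly_ring d) = polys d"
  "mult (poly_ring d) = (*)" "one (poly_ring d) = 1"
  "zero (poly_ring d) = 0" "add (poly_ring d) = (+)"
  by (simp_all add: poly_ring_def)

lemma polys_add: "p \<in> polys d \<Longrightarrow> q \<in> polys d \<Longrightarrow> p + q \<in> polys d"
  using keys_add[of p q] by blast

lemma polys_mult: "p \<in> polys d \<Longrightarrow> q \<in> polys d \<Longrightarrow> p * q \<in> polys d"
  using keys_mult[of p q] by fastforce

lemma polys_single: "m \<in> monomials d \<Longrightarrow> Poly_Mapping.single m c \<in> polys d"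
  by auto

lemma polys_const: "const_poly c \<in> polys d"
  by (auto simp: const_poly_def)

lemma polys_var: "i \<in> {1..d} \<Longrightarrow> var i \<in> polys d"
  by (auto simp: var_def)

lemma polys_diff: "p \<in> polys d \<Longrightarrow> q \<in> polys d \<Longrightarrow> p - q \<in> polys d"
  using polys_add[of p d "- q"] by simp

lemma polys_sum: "(\<And>i. i \<in> A \<Longrightarrow> f i \<in> polys d) \<Longrightarrow> sum f A \<in> polys d"
  by (induction A rule: infinite_finite_induct) (use polys_add in auto)

lemma polys_power: "p \<in> polys d \<Longrightarrow> p ^ n \<in> polys d"
proof (induction n)
  case (Suc n)
  then show ?case using polys_mult[of p d "p ^ n"] by simp
qed auto

lemma cring_poly_ring: "cring (poly_ring d)"
proof (rule cringI)
  show "abelian_group (poly_ring d)"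
  proof (rule abelian_groupI)
    fix p assume "p \<in> carrier (poly_ring d)"
    then show "\<exists>q\<in>carrier (poly_ring d). q \<oplus>\<^bsub>poly_ring d\<^esub> p = \<zero>\<^bsub>poly_ring d\<^esub>"
      by (auto intro!: exI[of _ "- p"])
  qed (auto simp: add_ac dest!: subsetD[OF keys_add])
  show "comm_monoid (poly_ring d)"
  proof (rule comm_monoidI)
    fix p q
    assume "p \<in> carrier (poly_ring d)" "q \<in> carrier (poly_ring d)"
    then show "p \<otimes>\<^bsub>poly_ring d\<^esub> q \<in> carrier (poly_ring d)"
      unfolding poly_ring_simps by (rule polys_mult)
  qed (auto simp: mult_ac)
qed (auto simp: algebra_simps)

lemma poly_ring_uminus:
  assumes "p \<in> polys d"
  shows "\<ominus>\<^bsub>poly_ring d\<^esub> p = - p"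
proof -
  interpret cring "poly_ring d" by (rule cring_poly_ring)
  show ?thesis by (rule minus_equality) (use assms in auto)
qed

lemma poly_ring_minus:
  assumes "p \<in> polys d" "q \<in> polys d"
  shows "p \<ominus>\<^bsub>poly_ring d\<^esub> q = p - q"
  using assms by (simp add: a_minus_def poly_ring_uminus)

lemma poly_ideal_iff:
  "ideal J (poly_ring d) \<longleftrightarrow> J \<subseteq> polys d \<and> 0 \<in> J \<and> (\<forall>p\<in>J. \<forall>q\<in>J. p + q \<in> J) \<and>
     (\<forall>p\<in>J. \<forall>r\<in>polys d. r * p \<in> J)" (is "_ \<longleftrightarrow> ?rhs")
proof
  interpret cring "poly_ring d" by (rule cring_poly_ring)
  show ?rhs if "ideal J (poly_ring d)"
  proof -
    interpret J: ideal J "poly_ring d" by (rule that)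
    show ?thesis
      using J.a_subset J.zero_closed J.a_closed J.I_l_closed by simp
  qed
  show "ideal J (poly_ring d)" if R: ?rhs
  proof (rule idealI)
    show "ring (poly_ring d)" by (rule ring_axioms)
    show "subgroup J (add_monoid (poly_ring d))"
    proof (rule add.subgroupI)
      fix p assume p: "p \<in> J"
      then have "p \<in> polys d" using R by blast
      moreover have "- 1 * p \<in> J" using R p polys_const[of "- 1" d]
        by (metis const_poly_def single_one single_uminus)
      ultimately show "\<ominus>\<^bsub>poly_ring d\<^esub> p \<in> J"
        by (simp add: poly_ring_uminus)
    qed (use R in auto)
  qed (use R in \<open>auto simp: mult.commute\<close>)
qed

lemma
  assumes "ideal J (poly_ring d)"
  shows poly_ideal_subset: "J \<subseteq> polys d"
    and poly_ideal_0: "0 \<in> J"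
    and poly_ideal_add: "p \<in> J \<Longrightarrow> q \<in> J \<Longrightarrow> p + q \<in> J"
    and poly_ideal_mult: "p \<in> J \<Longrightarrow> r \<in> polys d \<Longrightarrow> r * p \<in> J"
    and poly_ideal_mult_right: "p \<in> J \<Longrightarrow> r \<in> polys d \<Longrightarrow> p * r \<in> J"
  using assms by (auto simp: poly_ideal_iff mult.commute)

lemma poly_ideal_diff:
  assumes "ideal J (poly_ring d)" "p \<in> J" "q \<in> J"
  shows "p - q \<in> J"
proof -
  have "- 1 * q \<in> J"
    by (rule poly_ideal_mult[OF assms(1,3)]) simp
  then show ?thesis using poly_ideal_add[OF assms(1,2)] by fastforce
qed

lemma poly_ideal_sum:
  assumes "ideal J (poly_ring d)" "\<And>i. i \<in> A \<Longrightarrow> f i \<in> J"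
  shows "sum f A \<in> J"
  using assms(2)
  by (induction A rule: infinite_finite_induct) (use assms(1) in \<open>auto simp: poly_ideal_iff\<close>)

lemma poly_ideal_const_mult:
  assumes "ideal J (poly_ring d)" "p \<in> J"
  shows "const_poly c * p \<in> J"
  by (rule poly_ideal_mult[OF assms polys_const])

lemma ideal_genideal_poly:
  assumes "F \<subseteq> polys d"
  shows "ideal (Idl\<^bsub>poly_ring d\<^esub> F) (poly_ring d)"
  using cring.axioms(1)[OF cring_poly_ring] assms by (simp add: ring.genideal_ideal)

lemma genideal_poly_self: "F \<subseteq> polys d \<Longrightarrow> F \<subseteq> Idl\<^bsub>poly_ring d\<^esub> F"
  using ring.genideal_self[OF cring.axioms(1)[OF cring_poly_ring], of F d] by simp

lemma genideal_poly_minimal: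
  "ideal J (poly_ring d) \<Longrightarrow> F \<subseteq> J \<Longrightarrow> Idl\<^bsub>poly_ring d\<^esub> F \<subseteq> J"
  by (rule ring.genideal_minimal[OF cring.axioms(1)[OF cring_poly_ring]])

lemma const_poly_add: "const_poly (a + b) = const_poly a + const_poly b"
  by (simp add: const_poly_def single_add)

lemma const_poly_mult: "const_poly (a * b) = const_poly a * const_poly b"
  by (simp add: const_poly_def mult_single)

lemma const_poly_0 [simp]: "const_poly 0 = 0"
  by (simp add: const_poly_def)

lemma const_poly_1 [simp]: "const_poly 1 = 1"
  by (simp add: const_poly_def)

lemma const_poly_uminus: "const_poly (- a) = - const_poly a"
  by (simp add: const_poly_def single_uminus)

lemma linear_extension_const_mult [simp]:
  "linear_extension w (const_poly c * p) = c * linear_extension w p"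
  by (simp add: const_poly_def linear_extension_single_mult)

lemma linear_extension_scale: "linear_extension (\<lambda>m. k * w m) p = k * linear_extension w p"
  by (simp add: linear_extension_def sum_distrib_left mult_ac)

lemma homogeneous_add: "homogeneous n f \<Longrightarrow> homogeneous n g \<Longrightarrow> homogeneous n (f + g)"
  using keys_add[of f g] by (auto simp: homogeneous_iff)

lemma homogeneous_const_mult: "homogeneous n f \<Longrightarrow> homogeneous n (const_poly c * f)"
  using keys_single_mult[of 0 c f] by (auto simp: homogeneous_iff const_poly_def)

text \<open>The image of this subfield in the quotient is the field of scalars over which
  \<open>hilbert_function\<close> takes dimensions.\<close>

lemma subfield_constants: "subfield (range const_poly) (poly_ring d)"
proof -
  interpret cring "poly_ring d" by (rule cring_poly_ring)
  show ?thesis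
  proof (rule subfieldI)
    show "subcring (range const_poly) (poly_ring d)"
    proof (rule subcringI', rule subringI)
      show "range const_poly \<subseteq> carrier (poly_ring d)" using polys_const by auto
      show "\<one>\<^bsub>poly_ring d\<^esub> \<in> range const_poly"
        using rangeI[of const_poly 1] by simp
      show "\<ominus>\<^bsub>poly_ring d\<^esub> h \<in> range const_poly" if "h \<in> range const_poly" for h
        using that polys_const by (auto simp: poly_ring_uminus simp flip: const_poly_uminus)
    qed (auto simp flip: const_poly_add const_poly_mult)
    have "const_poly a \<in> Units (poly_ring d\<lparr>carrier := range const_poly\<rparr>) \<longleftrightarrow> a \<noteq> 0" for a
    proof
      assume "a \<noteq> 0"
      then have "const_poly (inverse a) * const_poly a = 1" "const_poly a * const_poly (inverse a) = 1"
        by (simp_all flip: const_poly_mult)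
      then show "const_poly a \<in> Units (poly_ring d\<lparr>carrier := range const_poly\<rparr>)"
        by (auto simp: Units_def)
    qed (auto simp: Units_def)
    moreover have "const_poly a = 0 \<longleftrightarrow> a = 0" for a
      by (metis const_poly_0 const_poly_def lookup_single_eq)
    moreover have "Units (poly_ring d\<lparr>carrier := range const_poly\<rparr>) \<subseteq> range const_poly"
      by (auto simp: Units_def)
    moreover have "0 \<notin> Units (poly_ring d\<lparr>carrier := range const_poly\<rparr>)" by (simp add: Units_def)
    ultimately show "Units (poly_ring d\<lparr>carrier := range const_poly\<rparr>) = range const_poly - {\<zero>\<^bsub>poly_ring d\<^esub>}"
      by (auto simp: subset_iff image_iff)
  qed
qed

lemma coset_eq_iff:
  assumes "ideal I (poly_ring d)" "f \<in> polys d" "g \<in> polys d"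
  shows "I +>\<^bsub>poly_ring d\<^esub> f = I +>\<^bsub>poly_ring d\<^esub> g \<longleftrightarrow> f - g \<in> I"
  using ring.quotient_eq_iff_same_a_r_cos[OF cring.axioms(1)[OF cring_poly_ring] assms(1), of f g]
    assms by (simp add: poly_ring_minus)

lemma var_power: "var i ^ k = Poly_Mapping.single (Poly_Mapping.single i k) 1"
  by (induction k) (simp_all add: var_def mult_single flip: single_add)

lemma const_poly_power: "const_poly (a ^ k) = const_poly a ^ k"
  by (induction k) (simp_all add: const_poly_mult)


subsection \<open>Noetherian property\<close>

lemma nat_seq_mono_subseq:
  fixes f :: "nat \<Rightarrow> nat"
  shows "\<exists>r :: nat \<Rightarrow> nat. strict_mono r \<and> mono (\<lambda>n. f (r n))"
proof -
  obtain g where g: "strict_mono g" "monoseq (\<lambda>n. f (g n))"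
    using seq_monosub by blast
  show ?thesis
  proof (cases "\<forall>m. \<forall>n\<ge>m. f (g m) \<le> f (g n)")
    case True
    then have "mono (\<lambda>n. f (g n))" by (auto intro: monoI)
    with g(1) show ?thesis by blast
  next
    case False
    with g(2) have dec: "f (g n) \<le> f (g m)" if "m \<le> n" for m n
      using that by (auto simp: monoseq_def)
    \<comment> \<open>A nonincreasing sequence of natural numbers is constant from the place where
      it attains its minimum.\<close>
    obtain N where N: "\<And>n. f (g N) \<le> f (g n)"
      using ex_has_least_nat[of "\<lambda>_. True" 0 "\<lambda>n. f (g n)"] by auto
    have "f (g (n + N)) = f (g N)" for n
      using dec[of N "n + N"] N[of "n + N"] by simp
    then have "mono (\<lambda>n. f (g (n + N)))" by (auto intro: monoI)
    moreover have "strict_mono (\<lambda>n. g (n + N))"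
      using g(1) by (auto simp: strict_mono_def)
    ultimately show ?thesis by blast
  qed
qed

lemma nat_vector_seq_mono_subseq:
  fixes f :: "nat \<Rightarrow> 'i \<Rightarrow> nat"
  assumes "finite A"
  shows "\<exists>r :: nat \<Rightarrow> nat. strict_mono r \<and> (\<forall>i\<in>A. mono (\<lambda>n. f (r n) i))"
  using assms
proof induction
  case empty
  then show ?case by (auto intro: exI[of _ "\<lambda>n. n"] simp: strict_mono_def)
next
  case (insert i A)
  then obtain r :: "nat \<Rightarrow> nat" where r: "strict_mono r" "\<And>j. j \<in> A \<Longrightarrow> mono (\<lambda>n. f (r n) j)" by blast
  obtain s :: "nat \<Rightarrow> nat" where s: "strict_mono s" "mono (\<lambda>n. f (r (s n)) i)"
    using nat_seq_mono_subseq[of "\<lambda>n. f (r n) i"] by blast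
  have "strict_mono (\<lambda>n. r (s n))"
    using r(1) s(1) by (auto simp: strict_mono_def)
  moreover have "mono (\<lambda>n. f (r (s n)) j)" if "j \<in> insert i A" for j
  proof (cases "j = i")
    case False
    then show ?thesis
      using r(2)[of j] that strict_mono_mono[OF s(1)] by (auto simp: mono_def)
  qed (use s in simp)
  ultimately show ?case by blast
qed

text \<open>Dickson's lemma for sequences: along a subsequence all d exponents are nondecreasing, so
  its first term divides its second.\<close>

lemma Dickson_seq:
  fixes m :: "nat \<Rightarrow> monomial"
  assumes "\<And>n. m n \<in> monomials d"
  shows "\<exists>i j. i < j \<and> (\<exists>u\<in>monomials d. m j = m i + u)"
proof -
  have "\<exists>r :: nat \<Rightarrow> nat. strict_mono r \<and> (\<forall>i\<in>{1..d}. mono (\<lambda>n. Poly_Mapping.lookup (m (r n)) i))"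
    using nat_vector_seq_mono_subseq[of "{1..d}" "\<lambda>n. Poly_Mapping.lookup (m n)", OF finite_atLeastAtMost] .
  then obtain r :: "nat \<Rightarrow> nat"
    where r: "strict_mono r" "\<And>i. i \<in> {1..d} \<Longrightarrow> mono (\<lambda>n. Poly_Mapping.lookup (m (r n)) i)"
    by blast
  have zero: "Poly_Mapping.lookup (m n) i = 0" if "i \<notin> {1..d}" for n i
    using assms[of n] that by (auto simp: monomials_def in_keys_iff subset_iff)
  have le: "Poly_Mapping.lookup (m (r 0)) i \<le> Poly_Mapping.lookup (m (r 1)) i" for i
    using r(2)[of i] zero[of i] by (cases "i \<in> {1..d}") (auto simp: mono_def)
  then have eq: "m (r 1) = m (r 0) + (m (r 1) - m (r 0))"
    by (intro poly_mapping_eqI) (simp add: lookup_add lookup_minus)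
  then have "m (r 1) - m (r 0) \<in> monomials d"
    using assms[of "r 1"] monomials_add by metis
  moreover have "r 0 < r 1" using r(1) by (simp add: strict_mono_def)
  ultimately show ?thesis using eq by blast
qed

lemma Dickson_finite:
  assumes "U \<subseteq> monomials d"
  shows "\<exists>F\<subseteq>U. finite F \<and> (\<forall>m\<in>U. \<exists>g\<in>F. \<exists>u\<in>monomials d. m = g + u)"
proof (rule ccontr)
  assume contr: "\<not> ?thesis"
  define bad where "bad F m \<longleftrightarrow> m \<in> U \<and> (\<forall>g\<in>F. \<forall>u\<in>monomials d. m \<noteq> g + u)" for F m
  define pick where "pick F = (SOME m. bad F m)" for F
  have pick: "bad F (pick F)" if "F \<subseteq> U" "finite F" for F
  proof -
    have "\<not> (\<forall>m\<in>U. \<exists>g\<in>F. \<exists>u\<in>monomials d. m = g + u)"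
      using contr that by auto
    then have "\<exists>m. bad F m" by (auto simp: bad_def)
    then show ?thesis unfolding pick_def by (rule someI_ex)
  qed
  \<comment> \<open>If no finite subset worked, monomials could be chosen greedily, none divisible
    by an earlier one, against \<open>Dickson_seq\<close>.\<close>
  define L where "L = rec_nat {} (\<lambda>_ F. insert (pick F) F)"
  have L_simps [simp]: "L 0 = {}" "L (Suc n) = insert (pick (L n)) (L n)" for n
    by (simp_all add: L_def)
  have L: "L n \<subseteq> U \<and> finite (L n)" for n
    by (induction n) (use pick in \<open>auto simp: bad_def\<close>)
  have L_mem: "pick (L i) \<in> L j" if "i < j" for i j
    using that by (induction j) (auto simp: less_Suc_eq)
  have "pick (L n) \<in> monomials d" for n
    using pick[of "L n"] L assms by (auto simp: bad_def)
  then obtain i j u where "i < j" "u \<in> monomials d" "pick (L j) = pick (L i) + u"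
    using Dickson_seq[of "\<lambda>n. pick (L n)"] by blast
  then show False
    using pick[of "L j"] L L_mem[of i j] by (auto simp: bad_def)
qed

text \<open>Here \<open><\<close> is the lexicographic order that the type of finitely supported
  maps carries. It only serves to define leading monomials in the basis theorem and is unrelated to
  the orders \<open>ord\<close> of the theorem.\<close>

lemma zero_le_monomial: "0 \<le> (m :: monomial)"
proof -
  have "\<not> m < 0" by transfer (auto simp: less_fun_def)
  then show ?thesis by simp
qed

text \<open>The restriction to d variables matters: in infinitely many variables the lexicographic
  order has infinite descending chains. With d variables, a later term of such a chain would be a
  multiple of an earlier one, hence not smaller.\<close>

lemma wf_monomials: "wf {(m, m'). m < m' \<and> m \<in> monomials d \<and> m' \<in> monomials d}"
  unfolding wf_iff_no_infinite_down_chain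
proof
  assume "\<exists>f. \<forall>i. (f (Suc i), f i) \<in> {(m, m'). m < m' \<and> m \<in> monomials d \<and> m' \<in> monomials d}"
  then obtain f where f: "\<And>i. f (Suc i) < f i" "\<And>i. f i \<in> monomials d" by blast
  from Dickson_seq[of f, OF f(2)] obtain i j u where ij: "i < j" "f j = f i + u" by blast
  have "f j < f i"
    using ij(1) by (induction j) (use f(1) in \<open>auto simp: less_Suc_eq intro: less_trans\<close>)
  moreover have "f i \<le> f j"
    using add_left_mono[OF zero_le_monomial[of u], of "f i"] ij(2) by simp
  ultimately show False by simp
qed

text \<open>Hilbert's basis theorem by division: finitely many elements of \<open>J\<close> have
  leading monomials dividing all the others, and subtracting multiples of them lowers the leading
  monomial until 0 is reached.\<close>

lemma noetherian_poly_ring: "noetherian_ring (poly_ring d)"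
proof -
  interpret cring "poly_ring d" by (rule cring_poly_ring)
  define lm :: "cpoly \<Rightarrow> monomial" where "lm f = Max (Poly_Mapping.keys f)" for f
  have lm_in: "lm f \<in> Poly_Mapping.keys f" if "f \<noteq> 0" for f
    using that Max_in[of "Poly_Mapping.keys f"] by (simp add: lm_def)
  have lm_ge: "k \<le> lm f" if "k \<in> Poly_Mapping.keys f" for f k
    using that by (simp add: lm_def)
  show ?thesis
  proof (rule noetherian_ringI)
    fix J assume J: "ideal J (poly_ring d)"
    have sub: "J \<subseteq> polys d" by (rule poly_ideal_subset[OF J])
    have lm_mon: "lm f \<in> monomials d" if "f \<in> J" "f \<noteq> 0" for f
      using lm_in[OF that(2)] sub that(1) by blast
    then have "lm ` (J - {0}) \<subseteq> monomials d" by auto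
    from Dickson_finite[OF this] obtain F where F: "F \<subseteq> lm ` (J - {0})" "finite F"
      "\<And>m. m \<in> lm ` (J - {0}) \<Longrightarrow> \<exists>g\<in>F. \<exists>u\<in>monomials d. m = g + u" by metis
    then obtain G where G: "G \<subseteq> J - {0}" "finite G" "F = lm ` G"
      using finite_subset_image[of F lm "J - {0}"] by auto
    have Gsub: "G \<subseteq> polys d" using G(1) sub by blast
    note idl = ideal_genideal_poly[OF Gsub]
    have "f \<in> Idl\<^bsub>poly_ring d\<^esub> G" if "f \<in> J" "lm f = m" for f m
      using that
    proof (induction m arbitrary: f rule: wf_induct_rule[OF wf_monomials[of d]])
      case (1 m f)
      show ?case
      proof (cases "f = 0")
        case True
        then show ?thesis using poly_ideal_0[OF idl] by simp
      next
        case False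
        with 1(2) F(3) obtain a u where au: "a \<in> F" "u \<in> monomials d" "lm f = a + u"
          by blast
        then obtain g where g: "g \<in> G" "a = lm g" using G(3) by blast
        \<comment> \<open>Chosen so that \<open>q\<close> has the leading term of \<open>f\<close>;
          then \<open>f - q\<close> is 0 or has a smaller leading monomial.\<close>
        define c where "c = Poly_Mapping.lookup f (lm f) / Poly_Mapping.lookup g (lm g)"
        define q where "q = Poly_Mapping.single u c * g"
        have g0: "g \<noteq> 0" "g \<in> J" using g G by auto
        have q_J: "q \<in> J" "q \<in> Idl\<^bsub>poly_ring d\<^esub> G"
          unfolding q_def
          using poly_ideal_mult[OF J g0(2)] poly_ideal_mult[OF idl] genideal_poly_self[OF Gsub] g(1)
            polys_single[OF au(2), of c] by blast+
        have lead: "Poly_Mapping.lookup q (lm f) = Poly_Mapping.lookup f (lm f)"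
          using lm_in[OF g0(1)] lookup_single_mult[of u c g "lm g"]
          by (simp add: q_def c_def au(3) g(2) add.commute in_keys_iff)
        have q_le: "k \<le> lm f" if "k \<in> Poly_Mapping.keys q" for k
          using that keys_single_mult[of u c g] lm_ge[of _ g] unfolding q_def au(3) g(2)
          by (fastforce simp: add.commute[of _ u] intro: add_left_mono)
        have "f - q \<in> Idl\<^bsub>poly_ring d\<^esub> G"
        proof (cases "f - q = 0")
          case True
          then show ?thesis using poly_ideal_0[OF idl] by simp
        next
          case False
          have fq: "f - q \<in> J" by (rule poly_ideal_diff[OF J 1(2) q_J(1)])
          have k: "lm (f - q) \<in> Poly_Mapping.keys (f - q)" by (rule lm_in[OF False])
          then have "lm (f - q) \<in> Poly_Mapping.keys f \<or> lm (f - q) \<in> Poly_Mapping.keys q"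
            by (auto simp: in_keys_iff lookup_minus)
          then have "lm (f - q) \<le> lm f" using lm_ge q_le by blast
          moreover have "lm (f - q) \<noteq> lm f"
            using k lead by (auto simp: in_keys_iff lookup_minus)
          ultimately have "(lm (f - q), m) \<in> {(m, m'). m < m' \<and> m \<in> monomials d \<and> m' \<in> monomials d}"
            using lm_mon[OF fq False] lm_mon[OF 1(2) \<open>f \<noteq> 0\<close>] 1(3) by auto
          from 1(1)[OF this fq] show ?thesis by simp
        qed
        from poly_ideal_add[OF idl this q_J(2)] show ?thesis by simp
      qed
    qed
    then have "J = Idl\<^bsub>poly_ring d\<^esub> G"
      using genideal_poly_minimal[OF J, of G] G(1) by auto
    then show "\<exists>A\<subseteq>carrier (poly_ring d). finite A \<and> J = Idl\<^bsub>poly_ring d\<^esub> A"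
      using Gsub G(2) by (auto intro!: exI[of _ G])
  qed
qed


subsection \<open>Regular sequences and chains of prime ideals\<close>

text \<open>An ideal \<open>M\<close> that is maximal among those containing \<open>J\<close> and
  disjoint from the multiplicative set \<open>T\<close> is prime: for a and b outside
  \<open>M\<close>, both M + (a) and M + (b) meet \<open>T\<close>, and the product of the two
  elements found would lie in \<open>M\<close> as soon as ab does.\<close>

lemma (in cring) primeideal_avoiding_exists:
  assumes J: "ideal J R" and T: "T \<subseteq> carrier R" "\<one> \<in> T"
    and T_mult: "\<And>s t. s \<in> T \<Longrightarrow> t \<in> T \<Longrightarrow> s \<otimes> t \<in> T" and disj: "J \<inter> T = {}"
  shows "\<exists>Q. primeideal Q R \<and> J \<subseteq> Q \<and> Q \<inter> T = {}"
proof -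
  define A where "A = {I. ideal I R \<and> J \<subseteq> I \<and> I \<inter> T = {}}"
  have "\<exists>M\<in>A. \<forall>X\<in>A. M \<subseteq> X \<longrightarrow> X = M"
  proof (rule subset_Zorn_nonempty)
    show "A \<noteq> {}" using J disj by (auto simp: A_def)
    fix C assume C: "C \<noteq> {}" "subset.chain A C"
    then have "subset.chain {I. ideal I R} C"
      by (auto simp: A_def pred_on.chain_def)
    from chain_Union_is_ideal[OF this] C(1) have "ideal (\<Union>C) R" by simp
    moreover have "C \<subseteq> A" using C(2) by (simp add: pred_on.chain_def)
    ultimately show "\<Union>C \<in> A" using C(1) by (auto simp: A_def)
  qed
  then obtain M where M: "ideal M R" "J \<subseteq> M" "M \<inter> T = {}"
    and max: "\<And>X. ideal X R \<Longrightarrow> J \<subseteq> X \<Longrightarrow> X \<inter> T = {} \<Longrightarrow> M \<subseteq> X \<Longrightarrow> X = M"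
    by (auto simp: A_def)
  interpret M: ideal M R by (rule M)
  have meet: "\<exists>q\<in>M. \<exists>r\<in>carrier R. q \<oplus> r \<otimes> a \<in> T" if a: "a \<in> carrier R" "a \<notin> M" for a
  proof (rule ccontr)
    assume none: "\<not> ?thesis"
    let ?X = "M <+>\<^bsub>R\<^esub> PIdl a"
    have idl: "ideal ?X R" by (intro add_ideals M cgenideal_ideal a)
    have mem: "x \<in> ?X \<longleftrightarrow> (\<exists>q\<in>M. \<exists>r\<in>carrier R. x = q \<oplus> r \<otimes> a)" for x
      by (auto simp: set_add_def' cgenideal_def)
    have sub: "M \<subseteq> ?X"
    proof
      fix x assume x: "x \<in> M"
      then have "x = x \<oplus> \<zero> \<otimes> a" using a M.Icarr by simp
      then show "x \<in> ?X" using x mem by blast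
    qed
    have "a = \<zero> \<oplus> \<one> \<otimes> a" using a by simp
    then have "a \<in> ?X" using mem[of a] M.zero_closed one_closed by blast
    moreover have "?X \<inter> T = {}" using none by (auto simp: mem)
    ultimately have "?X = M" using max[OF idl] M(2) sub by blast
    with \<open>a \<in> ?X\<close> a show False by simp
  qed
  have "primeideal M R"
  proof (rule primeidealI[OF M(1) is_cring])
    show "carrier R \<noteq> M" using M(3) T by blast
    fix a b assume a: "a \<in> carrier R" and b: "b \<in> carrier R" and ab: "a \<otimes> b \<in> M"
    show "a \<in> M \<or> b \<in> M"
    proof (rule ccontr)
      assume "\<not> ?thesis"
      with meet a b obtain q r q' r' where qr: "q \<in> M" "r \<in> carrier R" "q \<oplus> r \<otimes> a \<in> T"
        "q' \<in> M" "r' \<in> carrier R" "q' \<oplus> r' \<otimes> b \<in> T" by metis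
      have c: "q \<in> carrier R" "q' \<in> carrier R" using qr M.Icarr by auto
      have "(q \<oplus> r \<otimes> a) \<otimes> (q' \<oplus> r' \<otimes> b)
          = q \<otimes> (q' \<oplus> r' \<otimes> b) \<oplus> ((r \<otimes> a) \<otimes> q' \<oplus> (r \<otimes> r') \<otimes> (a \<otimes> b))"
        using a b c qr by algebra
      moreover have "q \<otimes> (q' \<oplus> r' \<otimes> b) \<in> M" "(r \<otimes> a) \<otimes> q' \<in> M" "(r \<otimes> r') \<otimes> (a \<otimes> b) \<in> M"
        using qr a b c ab M.I_l_closed M.I_r_closed by simp_all
      then have "q \<otimes> (q' \<oplus> r' \<otimes> b) \<oplus> ((r \<otimes> a) \<otimes> q' \<oplus> (r \<otimes> r') \<otimes> (a \<otimes> b)) \<in> M"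
        using M.a_closed by blast
      ultimately show False using T_mult[OF qr(3,6)] M(3) by auto
    qed
  qed
  with M show ?thesis by blast
qed

text \<open>The last element \<open>x\<close> is a nonzerodivisor modulo the ideal \<open>J\<close>
  of the others, so some prime Q with J <= Q <= P does not contain \<open>x\<close>. The inclusion
  of Q in P is strict, and induction continues with the shorter sequence inside Q.\<close>

lemma (in cring) regular_sequence_prime_chain:
  assumes "regular_sequence R xs" "set xs \<subseteq> P" "primeideal P R"
  shows "\<exists>Q. (\<forall>i\<le>length xs. primeideal (Q i) R \<and> Q i \<subseteq> P) \<and> (\<forall>i<length xs. Q i \<subset> Q (Suc i))"
  using assms
proof (induction xs arbitrary: P rule: rev_induct)
  case Nil
  then show ?case by (intro exI[of _ "\<lambda>_. P"]) simp
next
  case (snoc x ys)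
  interpret P: primeideal P R by (rule snoc.prems)
  define J where "J = Idl (set ys)"
  have ys: "set ys \<subseteq> carrier R" and x: "x \<in> carrier R" "x \<in> P" and ysP: "set ys \<subseteq> P"
    using snoc.prems by (auto simp: regular_sequence_def)
  have J: "ideal J R" unfolding J_def by (rule genideal_ideal[OF ys])
  interpret J: ideal J R by (rule J)
  have JP: "J \<subseteq> P" unfolding J_def using ysP by (intro genideal_minimal P.is_ideal)
  have reg: "r \<in> J" if "r \<in> carrier R" "x \<otimes> r \<in> J" for r
    using snoc.prems(1) that unfolding regular_sequence_def J_def
    by (auto simp: nth_append dest!: conjunct2 spec[of _ "length ys"])
  have reg_pow: "s \<in> J" if "s \<in> carrier R" "s \<otimes> x [^] n \<in> J" for s and n :: nat
    using that
  proof (induction n arbitrary: s)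
    case (Suc n)
    have "s \<otimes> x [^] Suc n = x \<otimes> (s \<otimes> x [^] n)"
      using x Suc.prems by (simp add: m_ac)
    then have "x \<otimes> (s \<otimes> x [^] n) \<in> J" using Suc.prems(2) by metis
    moreover have "s \<otimes> x [^] n \<in> carrier R" by (rule m_closed[OF Suc.prems(1) nat_pow_closed[OF x(1)]])
    ultimately have "s \<otimes> x [^] n \<in> J" using reg by blast
    then show ?case by (rule Suc.IH[OF Suc.prems(1)])
  qed simp
  \<comment> \<open>Avoiding the complement of \<open>P\<close> forces Q into \<open>P\<close>,
    which replaces localization; avoiding \<open>x\<close> makes the inclusion strict. If s times a
    power of x lies in \<open>J\<close>, regularity gives s in \<open>J\<close>, hence in
    \<open>P\<close>; so \<open>J\<close> misses \<open>T\<close>.\<close>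
  define T where "T = {s \<otimes> x [^] n | s (n::nat). s \<in> carrier R \<and> s \<notin> P}"
  have one: "\<one> \<notin> P" using P.I_notcarr P.one_imp_carrier by blast
  have T1: "s \<in> T" if "s \<in> carrier R" "s \<notin> P" for s
    unfolding T_def using that by (auto intro!: exI[of _ s] exI[of _ "0::nat"])
  have "\<exists>Q. primeideal Q R \<and> J \<subseteq> Q \<and> Q \<inter> T = {}"
  proof (rule primeideal_avoiding_exists[OF J])
    show "T \<subseteq> carrier R" using x by (auto simp: T_def)
    show "\<one> \<in> T" using T1[OF _ one] by simp
    show "J \<inter> T = {}" using reg_pow JP by (auto simp: T_def)
    fix a b assume "a \<in> T" "b \<in> T"
    then obtain s m t n where st: "a = s \<otimes> x [^] (m::nat)" "s \<in> carrier R" "s \<notin> P"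
      "b = t \<otimes> x [^] (n::nat)" "t \<in> carrier R" "t \<notin> P" by (auto simp: T_def)
    have "a \<otimes> b = (s \<otimes> t) \<otimes> x [^] (m + n)"
      using st x by (simp add: m_ac nat_pow_mult[symmetric])
    moreover have "s \<otimes> t \<notin> P" using st P.I_prime by blast
    ultimately show "a \<otimes> b \<in> T" using st by (auto simp: T_def)
  qed
  then obtain Q where Q: "primeideal Q R" "J \<subseteq> Q" "Q \<inter> T = {}" by blast
  have QP: "Q \<subseteq> P"
  proof
    fix s assume "s \<in> Q"
    then show "s \<in> P"
      using T1[of s] Q(3) ideal.Icarr[OF primeideal.axioms(1)[OF Q(1)]] by blast
  qed
  have "x \<in> T" unfolding T_def using x one by (auto intro!: exI[of _ \<one>] exI[of _ "1::nat"])
  with Q(3) x(2) QP have strict: "Q \<subset> P" by blast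
  have "regular_sequence R ys"
    unfolding regular_sequence_def
  proof (intro conjI allI impI ballI ys)
    show "Idl (set ys) \<noteq> carrier R"
      using JP P.I_notcarr P.Icarr unfolding J_def by blast
    fix i r assume "i < length ys" "r \<in> carrier R" "ys ! i \<otimes> r \<in> Idl (set (take i ys))"
    then show "r \<in> Idl (set (take i ys))"
      using snoc.prems(1) unfolding regular_sequence_def
      by (auto simp: nth_append dest!: conjunct2 spec[of _ i])
  qed
  moreover have "set ys \<subseteq> Q" using genideal_self[OF ys] Q(2) by (simp add: J_def)
  ultimately obtain q where q: "\<And>i. i \<le> length ys \<Longrightarrow> primeideal (q i) R \<and> q i \<subseteq> Q"
    "\<And>i. i < length ys \<Longrightarrow> q i \<subset> q (Suc i)"
    using snoc.IH[OF _ _ Q(1)] by blast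
  define q' where "q' i = (if i \<le> length ys then q i else P)" for i
  show ?case
  proof (intro exI[of _ q'] conjI allI impI)
    fix i assume "i \<le> length (ys @ [x])"
    then show "primeideal (q' i) R" "q' i \<subseteq> P"
      using q(1)[of i] snoc.prems(3) strict by (auto simp: q'_def)
  next
    fix i assume "i < length (ys @ [x])"
    then show "q' i \<subset> q' (Suc i)"
      using q(1)[of i] q(2)[of i] strict by (auto simp: q'_def)
  qed
qed

lemma (in cring) depth_le_codim:
  assumes "primeideal P R"
  shows "ideal_depth R P \<le> prime_codim R P"
  unfolding ideal_depth_def
proof (rule Sup_least)
  fix z assume "z \<in> {enat (length xs) | xs. regular_sequence R xs \<and> set xs \<subseteq> P}"
  then obtain xs where xs: "z = enat (length xs)" "regular_sequence R xs" "set xs \<subseteq> P" by blast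
  show "z \<le> prime_codim R P"
    unfolding prime_codim_def xs(1)
    using regular_sequence_prime_chain[OF xs(2,3) assms] by (intro Sup_upper) blast
qed

text \<open>The two assumptions bound depth from below and codimension from above by the same
  \<open>n\<close>; \<open>depth_le_codim\<close> closes the gap.\<close>

lemma cohen_macaulay_ringI:
  assumes "cring R" "noetherian_ring R"
    and depth: "\<And>P. maximalideal P R \<Longrightarrow> \<exists>xs. length xs = n \<and> regular_sequence R xs \<and> set xs \<subseteq> P"
    and dim: "\<And>Q :: nat \<Rightarrow> 'a set. (\<And>i. i \<le> Suc n \<Longrightarrow> primeideal (Q i) R) \<Longrightarrow>
      (\<And>i. i < Suc n \<Longrightarrow> Q i \<subset> Q (Suc i)) \<Longrightarrow> False"
  shows "cohen_macaulay_ring (R :: ('a, 'b) ring_scheme)"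
  unfolding cohen_macaulay_ring_def
proof (intro conjI assms allI impI)
  interpret cring R by (rule assms)
  fix P assume P: "maximalideal P R"
  then have "primeideal P R" by (rule maximalideal_prime)
  from depth_le_codim[OF this] have "ideal_depth R P \<le> prime_codim R P" .
  moreover have "enat n \<le> ideal_depth R P"
    unfolding ideal_depth_def using depth[OF P] by (intro Sup_upper) blast
  moreover have "prime_codim R P \<le> enat n"
    unfolding prime_codim_def
  proof (rule Sup_least, safe)
    fix k and Q :: "nat \<Rightarrow> 'a set"
    assume Q: "\<forall>i\<le>k. primeideal (Q i) R \<and> Q i \<subseteq> P" "\<forall>i<k. Q i \<subset> Q (Suc i)"
    show "enat k \<le> enat n"
    proof (rule ccontr)
      assume "\<not> ?thesis"
      then have "Suc n \<le> k" by simp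
      with Q show False by (intro dim[of Q]) auto
    qed
  qed
  ultimately show "ideal_depth R P = prime_codim R P" by (meson order.trans antisym)
qed

section \<open>Ideals and regular sequences in quotient rings\<close>

lemma (in ideal) quot_carrier: "carrier (R Quot I) = (+>) I ` carrier R"
  by (auto simp: FactRing_simps)

lemma (in ideal) quot_genideal:
  assumes A: "A \<subseteq> carrier R"
  shows "Idl\<^bsub>R Quot I\<^esub> ((+>) I ` A) = (+>) I ` (Idl A)"
proof
  interpret q: ring_hom_ring R "R Quot I" "(+>) I" by (rule rcos_ring_hom_ring)
  have qA: "(+>) I ` A \<subseteq> carrier (R Quot I)" using A quot_carrier by blast
  have "ideal ((+>) I ` (Idl A)) (R Quot I)"
    by (rule ring_ideal_imp_quot_ideal[OF is_ideal genideal_ideal[OF A]])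
  then show "Idl\<^bsub>R Quot I\<^esub> ((+>) I ` A) \<subseteq> (+>) I ` (Idl A)"
    using genideal_self[OF A] by (intro q.S.genideal_minimal) auto
  have "ideal {r \<in> carrier R. I +> r \<in> Idl\<^bsub>R Quot I\<^esub> ((+>) I ` A)} R"
    by (intro q.ideal_vimage q.S.genideal_ideal qA)
  then have "Idl A \<subseteq> {r \<in> carrier R. I +> r \<in> Idl\<^bsub>R Quot I\<^esub> ((+>) I ` A)}"
    using A q.S.genideal_self[OF qA] by (intro genideal_minimal) auto
  then show "(+>) I ` (Idl A) \<subseteq> Idl\<^bsub>R Quot I\<^esub> ((+>) I ` A)" by blast
qed

lemma (in noetherian_ring) noetherian_quot:
  assumes "ideal I R"
  shows "noetherian_ring (R Quot I)"
proof -
  interpret I: ideal I R by (rule assms)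
  interpret q: ring_hom_ring R "R Quot I" "(+>) I" by (rule I.rcos_ring_hom_ring)
  show ?thesis
  proof (rule q.S.noetherian_ringI)
    fix J assume J: "ideal J (R Quot I)"
    let ?J = "{r \<in> carrier R. I +> r \<in> J}"
    obtain A where A: "A \<subseteq> carrier R" "finite A" "?J = Idl A"
      using finetely_gen[OF q.ideal_vimage[OF J]] by blast
    have "J \<subseteq> (+>) I ` carrier R"
      using I.quot_carrier additive_subgroup.a_subset[OF ideal.axioms(1)[OF J]] by simp
    then have "J = (+>) I ` ?J" by auto
    then have "J = Idl\<^bsub>R Quot I\<^esub> ((+>) I ` A)"
      using I.quot_genideal[OF A(1)] A(3) by simp
    then show "\<exists>B\<subseteq>carrier (R Quot I). finite B \<and> J = Idl\<^bsub>R Quot I\<^esub> B"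
      using A I.quot_carrier by (intro exI[of _ "(+>) I ` A"]) auto
  qed
qed

lemma zero_FactRing: "\<zero>\<^bsub>R Quot I\<^esub> = I"
  by (simp add: FactRing_def)

text \<open>Moves questions about ideals of the quotient to the ring itself, at the price of adding
  \<open>I\<close> to the generators; regularity can then be checked on polynomials instead of
  cosets.\<close>

lemma (in cring) quot_genideal_mem:
  assumes I: "ideal I R" and A: "A \<subseteq> carrier R" and f: "f \<in> carrier R"
  shows "I +> f \<in> Idl\<^bsub>R Quot I\<^esub> ((+>) I ` A) \<longleftrightarrow> f \<in> Idl (I \<union> A)"
proof -
  interpret I: ideal I R by (rule I)
  interpret q: ring_hom_ring R "R Quot I" "(+>) I" by (rule I.rcos_ring_hom_ring)
  have IA: "I \<union> A \<subseteq> carrier R" using I.a_subset A by blast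
  interpret J: ideal "Idl (I \<union> A)" R by (rule genideal_ideal[OF IA])
  have IAJ: "I \<union> A \<subseteq> Idl (I \<union> A)" by (rule genideal_self[OF IA])
  have qA: "(+>) I ` A \<subseteq> carrier (R Quot I)" using A I.quot_carrier by blast
  show ?thesis
  proof
    assume "I +> f \<in> Idl\<^bsub>R Quot I\<^esub> ((+>) I ` A)"
    then obtain g where g: "g \<in> Idl A" "I +> f = I +> g"
      unfolding I.quot_genideal[OF A] by blast
    have gJ: "g \<in> Idl (I \<union> A)"
      using g(1) subset_Idl_subset[OF IA, of A] genideal_minimal[OF J.is_ideal, of A] IAJ by blast
    then have gc: "g \<in> carrier R" by (rule J.Icarr)
    have "f \<ominus> g \<in> I" using quotient_eq_iff_same_a_r_cos[OF I f gc] g(2) by simp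
    then have "(f \<ominus> g) \<oplus> g \<in> Idl (I \<union> A)" using IAJ gJ J.a_closed by blast
    moreover have "(f \<ominus> g) \<oplus> g = f" using f gc by (simp add: a_minus_def a_assoc l_neg)
    ultimately show "f \<in> Idl (I \<union> A)" by simp
  next
    assume "f \<in> Idl (I \<union> A)"
    moreover have "Idl (I \<union> A) \<subseteq> {r \<in> carrier R. I +> r \<in> Idl\<^bsub>R Quot I\<^esub> ((+>) I ` A)}"
    proof (rule genideal_minimal)
      let ?Q = "Idl\<^bsub>R Quot I\<^esub> ((+>) I ` A)"
      have Q: "ideal ?Q (R Quot I)" by (rule q.S.genideal_ideal[OF qA])
      show "ideal {r \<in> carrier R. I +> r \<in> ?Q} R" by (rule q.ideal_vimage[OF Q])
      have "I +> r \<in> ?Q" if "r \<in> I" for r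
      proof -
        have zero: "I +> r = \<zero>\<^bsub>R Quot I\<^esub>"
          unfolding zero_FactRing by (rule I.a_rcos_const[OF that])
        show ?thesis
          unfolding zero by (rule additive_subgroup.zero_closed[OF ideal.axioms(1)[OF Q]])
      qed
      then show "I \<union> A \<subseteq> {r \<in> carrier R. I +> r \<in> ?Q}"
        using IA q.S.genideal_self[OF qA] by blast
    qed
    ultimately show "I +> f \<in> Idl\<^bsub>R Quot I\<^esub> ((+>) I ` A)" by blast
  qed
qed

lemma (in cring) regular_sequence_quotI:
  assumes I: "ideal I R" and fs: "set fs \<subseteq> carrier R"
    and proper: "Idl (I \<union> set fs) \<noteq> carrier R"
    and reg: "\<And>i r. i < length fs \<Longrightarrow> r \<in> carrier R \<Longrightarrow> fs ! i \<otimes> r \<in> Idl (I \<union> set (take i fs)) \<Longrightarrow>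
      r \<in> Idl (I \<union> set (take i fs))"
  shows "regular_sequence (R Quot I) (map ((+>) I) fs)"
  unfolding regular_sequence_def
proof (intro conjI allI impI ballI)
  interpret I: ideal I R by (rule I)
  interpret q: ring_hom_ring R "R Quot I" "(+>) I" by (rule I.rcos_ring_hom_ring)
  show "set (map ((+>) I) fs) \<subseteq> carrier (R Quot I)" using fs I.quot_carrier by auto
  have "I \<union> set fs \<subseteq> carrier R" using I.a_subset fs by blast
  then have "Idl (I \<union> set fs) \<subseteq> carrier R"
    by (rule additive_subgroup.a_subset[OF ideal.axioms(1)[OF genideal_ideal]])
  then obtain f where f: "f \<in> carrier R" "f \<notin> Idl (I \<union> set fs)" using proper by blast
  then have "I +> f \<notin> Idl\<^bsub>R Quot I\<^esub> (set (map ((+>) I) fs))"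
    using quot_genideal_mem[OF I fs f(1)] by simp
  then show "Idl\<^bsub>R Quot I\<^esub> (set (map ((+>) I) fs)) \<noteq> carrier (R Quot I)"
    using f(1) I.quot_carrier by blast
  fix i x
  assume i: "i < length (map ((+>) I) fs)" and x: "x \<in> carrier (R Quot I)"
    and mem: "map ((+>) I) fs ! i \<otimes>\<^bsub>R Quot I\<^esub> x \<in> Idl\<^bsub>R Quot I\<^esub> (set (take i (map ((+>) I) fs)))"
  obtain r where r: "r \<in> carrier R" "x = I +> r" using x I.quot_carrier by blast
  have i': "i < length fs" using i by simp
  then have fi: "fs ! i \<in> carrier R" using fs nth_mem by blast
  have take: "set (take i fs) \<subseteq> carrier R" by (rule subset_trans[OF set_take_subset fs])
  have eq: "set (take i (map ((+>) I) fs)) = (+>) I ` set (take i fs)" by (simp add: take_map)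
  have "I +> (fs ! i \<otimes> r) \<in> Idl\<^bsub>R Quot I\<^esub> ((+>) I ` set (take i fs))"
    using mem i' r fi unfolding eq by simp
  then have "fs ! i \<otimes> r \<in> Idl (I \<union> set (take i fs))"
    using quot_genideal_mem[OF I take, of "fs ! i \<otimes> r"] fi r by simp
  then have "r \<in> Idl (I \<union> set (take i fs))" by (rule reg[OF i' r(1)])
  then show "x \<in> Idl\<^bsub>R Quot I\<^esub> (set (take i (map ((+>) I) fs)))"
    unfolding eq r(2) using quot_genideal_mem[OF I take r(1)] by simp
qed

text \<open>Inverses in the residue field, expressed without forming it.\<close>

lemma (in cring) maximalideal_invertible:
  assumes "maximalideal P R" "a \<in> carrier R" "a \<notin> P"
  shows "\<exists>b\<in>carrier R. \<exists>p\<in>P. \<one> = p \<oplus> a \<otimes> b"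
proof -
  interpret P: maximalideal P R by (rule assms)
  let ?X = "P <+>\<^bsub>R\<^esub> PIdl a"
  have X: "ideal ?X R" by (intro add_ideals P.is_ideal cgenideal_ideal assms)
  have mem: "x \<in> ?X \<longleftrightarrow> (\<exists>p\<in>P. \<exists>r\<in>carrier R. x = p \<oplus> r \<otimes> a)" for x
    by (auto simp: set_add_def' cgenideal_def)
  have sub: "P \<subseteq> ?X"
  proof
    fix x assume x: "x \<in> P"
    then have "x = x \<oplus> \<zero> \<otimes> a" using assms P.Icarr by simp
    then show "x \<in> ?X" using x mem by blast
  qed
  have "a = \<zero> \<oplus> \<one> \<otimes> a" using assms by simp
  then have "a \<in> ?X" using mem[of a] P.zero_closed one_closed by blast
  then have "?X = carrier R"
    using P.I_maximal[OF X sub ideal.axioms(1)[OF X, THEN additive_subgroup.a_subset]] assms(3) by blast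
  then obtain p b where pb: "p \<in> P" "b \<in> carrier R" "\<one> = p \<oplus> b \<otimes> a" using mem[of \<one>] by auto
  then have "\<one> = p \<oplus> a \<otimes> b" using assms(2) by (simp add: m_comm)
  then show ?thesis using pb(1,2) by blast
qed


subsection \<open>Growth of the affine coordinate ring\<close>

text \<open>A homogeneous system with more unknowns \<open>c i\<close> than equations
  \<open>j\<close>, solved by Gaussian elimination.\<close>

lemma nontrivial_linear_relation:
  fixes a :: "'i \<Rightarrow> 'j \<Rightarrow> 'c::field"
  assumes "finite B" "finite A" "card B < card A"
  shows "\<exists>c. (\<exists>i\<in>A. c i \<noteq> 0) \<and> (\<forall>j\<in>B. (\<Sum>i\<in>A. c i * a i j) = 0)"
  using assms
proof (induction B arbitrary: A a rule: finite_induct)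
  case empty
  then have "A \<noteq> {}" by auto
  then show ?case by (intro exI[of _ "\<lambda>_. 1"]) auto
next
  case (insert j B)
  show ?case
  proof (cases "\<forall>i\<in>A. a i j = 0")
    case True
    obtain c where "\<exists>i\<in>A. c i \<noteq> 0" "\<forall>j\<in>B. (\<Sum>i\<in>A. c i * a i j) = 0"
      using insert.IH[of A a] insert.prems insert.hyps by auto
    with True show ?thesis by (intro exI[of _ c]) auto
  next
    case False
    then obtain i0 where i0: "i0 \<in> A" "a i0 j \<noteq> 0" by blast
    define A' where "A' = A - {i0}"
    have A': "A = insert i0 A'" "i0 \<notin> A'" "finite A'" using i0 insert.prems by (auto simp: A'_def)
    then have "card B < card A'" using insert.prems insert.hyps by simp
    \<comment> \<open>Equation \<open>j\<close> is used to eliminate the unknown of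
      \<open>i0\<close>, with pivot \<open>a i0 j\<close>.\<close>
    from insert.IH[OF A'(3) this, of "\<lambda>i k. a i k - a i j / a i0 j * a i0 k"]
    obtain c where c: "\<exists>i\<in>A'. c i \<noteq> 0"
      "\<And>k. k \<in> B \<Longrightarrow> (\<Sum>i\<in>A'. c i * (a i k - a i j / a i0 j * a i0 k)) = 0" by blast
    \<comment> \<open>Equation \<open>j\<close> forces the value \<open>- s\<close> for the
      eliminated unknown.\<close>
    define s where "s = (\<Sum>i\<in>A'. c i * a i j) / a i0 j"
    define c' where "c' = c(i0 := - s)"
    have sum: "(\<Sum>i\<in>A. c' i * a i k) = (\<Sum>i\<in>A'. c i * a i k) - s * a i0 k" for k
    proof -
      have "(\<Sum>i\<in>A'. c' i * a i k) = (\<Sum>i\<in>A'. c i * a i k)"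
        by (rule sum.cong) (use A' in \<open>auto simp: c'_def\<close>)
      then show ?thesis using A' by (simp add: c'_def)
    qed
    have "(\<Sum>i\<in>A. c' i * a i k) = 0" if "k \<in> insert j B" for k
    proof (cases "k = j")
      case True
      then show ?thesis using i0 sum by (simp add: s_def)
    next
      case False
      then have "k \<in> B" using that by simp
      have "(\<Sum>i\<in>A'. c i * (a i k - a i j / a i0 j * a i0 k))
         = (\<Sum>i\<in>A'. c i * a i k) - s * a i0 k"
        by (simp add: s_def algebra_simps sum_subtractf sum_distrib_left sum_distrib_right sum_divide_distrib)
      with c(2)[OF \<open>k \<in> B\<close>] sum show ?thesis by simp
    qed
    moreover have "\<exists>i\<in>A. c' i \<noteq> 0" using c(1) A' by (auto simp: c'_def)
    ultimately show ?thesis by blast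
  qed
qed

text \<open>Linear independence over the constants in the quotient by \<open>Q\<close>, for families
  rather than sets, so that two members in the same class count as dependent. Dimension bounds
  become bounds on the size of such families.\<close>

definition independent_mod :: "cpoly set \<Rightarrow> 'i set \<Rightarrow> ('i \<Rightarrow> cpoly) \<Rightarrow> bool" where
  "independent_mod Q A v \<longleftrightarrow> (\<forall>c. (\<Sum>i\<in>A. const_poly (c i) * v i) \<in> Q \<longrightarrow> (\<forall>i\<in>A. c i = 0))"

lemma independent_mod_reindex:
  assumes "independent_mod Q B w" "bij_betw h A B"
  shows "independent_mod Q A (\<lambda>i. w (h i))"
  unfolding independent_mod_def
proof (intro allI impI)
  fix c assume c: "(\<Sum>i\<in>A. const_poly (c i) * w (h i)) \<in> Q"
  have inv: "inv_into A h (h i) = i" if "i \<in> A" for i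
    using assms(2) that by (simp add: bij_betw_def)
  have "(\<Sum>b\<in>B. const_poly (c (inv_into A h b)) * w b) = (\<Sum>i\<in>A. const_poly (c i) * w (h i))"
    using inv by (subst sum.reindex_bij_betw[OF assms(2), symmetric]) (auto intro: sum.cong)
  with c assms(1) have "\<forall>b\<in>B. c (inv_into A h b) = 0"
    unfolding independent_mod_def by metis
  then show "\<forall>i\<in>A. c i = 0"
    using inv assms(2) by (metis bij_betwE)
qed

text \<open>A filtration instead of a grading, because the primes it is applied to need not be
  homogeneous.\<close>

definition polys_upto :: "nat \<Rightarrow> nat \<Rightarrow> cpoly set" where
  "polys_upto d n = {p \<in> polys d. \<forall>m\<in>Poly_Mapping.keys p. mdeg m \<le> n}"

lemma polys_upto_subset: "polys_upto d n \<subseteq> polys d"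
  by (auto simp: polys_upto_def)

lemma polys_upto_mono: "n \<le> n' \<Longrightarrow> polys_upto d n \<subseteq> polys_upto d n'"
  by (fastforce simp: polys_upto_def)

lemma polys_upto_exists:
  assumes "p \<in> polys d"
  shows "\<exists>n. p \<in> polys_upto d n"
  using assms by (intro exI[of _ "Max (mdeg ` Poly_Mapping.keys p)"]) (auto simp: polys_upto_def)

lemma polys_upto_add: "p \<in> polys_upto d n \<Longrightarrow> q \<in> polys_upto d n \<Longrightarrow> p + q \<in> polys_upto d n"
  unfolding polys_upto_def using keys_add[of p q] by blast

lemma polys_upto_0 [simp]: "0 \<in> polys_upto d n"
  by (simp add: polys_upto_def)

lemma polys_upto_sum: "(\<And>i. i \<in> A \<Longrightarrow> f i \<in> polys_upto d n) \<Longrightarrow> sum f A \<in> polys_upto d n"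
  by (induction A rule: infinite_finite_induct) (auto intro: polys_upto_add)

lemma polys_upto_mult:
  assumes "p \<in> polys_upto d n" "q \<in> polys_upto d n'"
  shows "p * q \<in> polys_upto d (n + n')"
proof -
  have "p * q \<in> polys d" using polys_mult[of p d q] assms polys_upto_subset by blast
  moreover have "mdeg m \<le> n + n'" if "m \<in> Poly_Mapping.keys (p * q)" for m
  proof -
    obtain a b where "m = a + b" "a \<in> Poly_Mapping.keys p" "b \<in> Poly_Mapping.keys q"
      using \<open>m \<in> Poly_Mapping.keys (p * q)\<close> keys_mult[of p q] by blast
    then show ?thesis using assms by (auto simp: polys_upto_def intro!: add_mono)
  qed
  ultimately show ?thesis by (simp add: polys_upto_def)
qed

lemma polys_upto_const: "const_poly c \<in> polys_upto d n"
  by (auto simp: polys_upto_def const_poly_def)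

lemma polys_upto_const_mult: "p \<in> polys_upto d n \<Longrightarrow> const_poly c * p \<in> polys_upto d n"
  using polys_upto_mult[OF polys_upto_const[of c d 0], of p n] by simp

lemma polys_upto_power: "p \<in> polys_upto d n \<Longrightarrow> p ^ j \<in> polys_upto d (j * n)"
proof (induction j)
  case 0
  then show ?case using polys_upto_const[of 1 d 0] by simp
next
  case (Suc j)
  then show ?case using polys_upto_mult[of p d n "p ^ j" "j * n"] by simp
qed

text \<open>The common kernel of the functionals on \<open>polys_upto d n\<close> lies in
  \<open>Q\<close>, so the image of this space in the quotient has dimension at most the number of
  functionals.\<close>

lemma independent_mod_card_le:
  assumes indep: "independent_mod Q {..<N} v" and v: "v ` {..<N} \<subseteq> polys_upto d n"
    and "finite B"
    and w: "\<And>p. p \<in> polys_upto d n \<Longrightarrow> (\<And>b. b \<in> B \<Longrightarrow> linear_extension (w b) p = 0) \<Longrightarrow> p \<in> Q"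
  shows "N \<le> card B"
proof (rule ccontr)
  assume "\<not> ?thesis"
  then have "card B < card {..<N}" by simp
  from nontrivial_linear_relation[OF \<open>finite B\<close> _ this, of "\<lambda>i b. linear_extension (w b) (v i)"]
  obtain c where c: "\<exists>i\<in>{..<N}. c i \<noteq> 0"
    "\<And>b. b \<in> B \<Longrightarrow> (\<Sum>i<N. c i * linear_extension (w b) (v i)) = 0" by auto
  have "(\<Sum>i<N. const_poly (c i) * v i) \<in> Q"
  proof (rule w)
    show "(\<Sum>i<N. const_poly (c i) * v i) \<in> polys_upto d n"
      using v by (intro polys_upto_sum polys_upto_const_mult) auto
    show "linear_extension (w b) (\<Sum>i<N. const_poly (c i) * v i) = 0" if "b \<in> B" for b
      using c(2)[OF that] by (simp add: linear_extension_sum)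
  qed
  with indep c(1) show False by (auto simp: independent_mod_def)
qed

lemma primeideal_polyD:
  assumes "primeideal Q (poly_ring d)" "p * q \<in> Q" "p \<in> polys d" "q \<in> polys d"
  shows "p \<in> Q \<or> q \<in> Q"
  using primeideal.I_prime[OF assms(1), of p q] assms by simp

lemma primeideal_poly_one:
  assumes "primeideal Q (poly_ring d)"
  shows "1 \<notin> Q"
proof
  assume "1 \<in> Q"
  then have "Q = carrier (poly_ring d)"
    using ideal.one_imp_carrier[OF primeideal.axioms(1)[OF assms]] by simp
  then show False using primeideal.I_notcarr[OF assms] by simp
qed

text \<open>This makes the order of growth drop when one passes to a larger prime ideal.\<close>

lemma independent_mod_powers:
  assumes Q: "primeideal Q (poly_ring d)" and Q': "ideal Q' (poly_ring d)" and "Q \<subseteq> Q'"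
    and f: "f \<in> Q'" "f \<notin> Q" "f \<in> polys_upto d e"
    and v: "independent_mod Q' {..<N} v" "v ` {..<N} \<subseteq> polys_upto d n"
  shows "\<exists>w. independent_mod Q {..<M * N} w \<and> w ` {..<M * N} \<subseteq> polys_upto d (n + M * e)"
proof -
  have fp: "f \<in> polys d" using f(3) polys_upto_subset by blast
  have vp: "v i \<in> polys d" if "i < N" for i using v(2) that polys_upto_subset by fastforce
  have comb: "(\<Sum>i<N. const_poly (c i) * v i) \<in> polys d" for c
    by (intro polys_sum polys_mult polys_const) (use vp in auto)
  \<comment> \<open>In a relation modulo \<open>Q\<close> between the products of powers of
    \<open>f\<close> with the \<open>v i\<close>, the part without \<open>f\<close> vanishes modulo
    \<open>Q'\<close>, so its coefficients are 0. What remains is divisible by \<open>f\<close>,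
    which can be cancelled because \<open>Q\<close> is prime and does not contain it.\<close>
  have indep: "\<forall>j<M. \<forall>i<N. c j i = 0"
    if "(\<Sum>j<M. f ^ j * (\<Sum>i<N. const_poly (c j i) * v i)) \<in> Q" for c
    using that
  proof (induction M arbitrary: c)
    case (Suc M)
    let ?p = "\<lambda>j. \<Sum>i<N. const_poly (c j i) * v i"
    let ?s = "\<Sum>j<M. f ^ j * ?p (Suc j)"
    have s: "?s \<in> polys d" by (intro polys_sum polys_mult polys_power fp comb)
    have eq: "(\<Sum>j<Suc M. f ^ j * ?p j) = ?p 0 + f * ?s"
      by (subst sum.lessThan_Suc_shift) (simp add: sum_distrib_left mult.assoc)
    have "?p 0 + f * ?s \<in> Q'" using Suc.prems eq \<open>Q \<subseteq> Q'\<close> by auto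
    then have "(?p 0 + f * ?s) - f * ?s \<in> Q'"
      by (intro poly_ideal_diff[OF Q'] poly_ideal_mult_right[OF Q' f(1) s])
    then have c0: "\<forall>i<N. c 0 i = 0" using v(1) unfolding independent_mod_def by auto
    then have "?p 0 = 0" by simp
    then have "f * ?s \<in> Q" using Suc.prems eq by simp
    then have "?s \<in> Q" using primeideal_polyD[OF Q _ fp s] f(2) by blast
    from Suc.IH[OF this] c0 show ?case by (metis less_Suc_eq_0_disj)
  qed simp
  let ?B = "{..<M} \<times> {..<N}"
  define u where "u = (\<lambda>(j, i). f ^ j * v i)"
  have ind: "independent_mod Q ?B u"
    unfolding independent_mod_def
  proof (intro allI impI)
    fix c assume c: "(\<Sum>b\<in>?B. const_poly (c b) * u b) \<in> Q"
    have "(\<Sum>b\<in>?B. const_poly (c b) * u b)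
        = (\<Sum>j<M. f ^ j * (\<Sum>i<N. const_poly (c (j, i)) * v i))"
      by (simp add: u_def sum.cartesian_product' sum_distrib_left algebra_simps split_def)
    with c indep[of "\<lambda>j i. c (j, i)"] show "\<forall>b\<in>?B. c b = 0" by auto
  qed
  have deg: "u b \<in> polys_upto d (n + M * e)" if "b \<in> ?B" for b
  proof -
    obtain j i where b: "b = (j, i)" "j < M" "i < N" using \<open>b \<in> ?B\<close> by auto
    have "f ^ j * v i \<in> polys_upto d (j * e + n)"
      using v(2) b by (intro polys_upto_mult polys_upto_power f) auto
    moreover have "j * e + n \<le> n + M * e" using b by simp
    then have "polys_upto d (j * e + n) \<subseteq> polys_upto d (n + M * e)" by (rule polys_upto_mono)
    ultimately show ?thesis unfolding u_def b by auto
  qed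
  obtain h where h: "bij_betw h {0..<card ?B} ?B"
    using ex_bij_betw_nat_finite[of ?B] by auto
  then have h: "bij_betw h {..<M * N} ?B" by (simp add: atLeast0LessThan)
  have "(\<lambda>i. u (h i)) ` {..<M * N} \<subseteq> polys_upto d (n + M * e)"
    using deg bij_betwE[OF h] by blast
  with independent_mod_reindex[OF ind h] show ?thesis by blast
qed

text \<open>Says that the Gelfand-Kirillov dimension of the quotient is at most \<open>k\<close>.
  The base is n + 1 so that the bound is not 0 at n = 0, where the class of 1 is already independent
  modulo a proper ideal.\<close>

definition growth_bounded :: "nat \<Rightarrow> cpoly set \<Rightarrow> nat \<Rightarrow> bool" where
  "growth_bounded d Q k \<longleftrightarrow> (\<exists>C. \<forall>n N v. independent_mod Q {..<N} v \<longrightarrow>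
     v ` {..<N} \<subseteq> polys_upto d n \<longrightarrow> N \<le> C * (n + 1) ^ k)"

lemma growth_bounded_mono:
  assumes "growth_bounded d Q k" "Q \<subseteq> Q'"
  shows "growth_bounded d Q' k"
proof -
  have "independent_mod Q A v" if "independent_mod Q' A v" for A :: "nat set" and v
    using that assms(2) by (auto simp: independent_mod_def)
  then show ?thesis using assms(1) unfolding growth_bounded_def by meson
qed

lemma growth_bounded_Suc:
  assumes Q: "primeideal Q (poly_ring d)" and Q': "ideal Q' (poly_ring d)" and "Q \<subset> Q'"
    and "growth_bounded d Q (Suc k)"
  shows "growth_bounded d Q' k"
proof -
  obtain f where f: "f \<in> Q'" "f \<notin> Q" using \<open>Q \<subset> Q'\<close> by blast
  then obtain e where e: "f \<in> polys_upto d e"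
    using polys_upto_exists poly_ideal_subset[OF Q'] by blast
  obtain C where C: "\<And>n N v. independent_mod Q {..<N} v \<Longrightarrow> v ` {..<N} \<subseteq> polys_upto d n \<Longrightarrow>
      N \<le> C * (n + 1) ^ Suc k"
    using assms(4) unfolding growth_bounded_def by blast
  have "N \<le> (C * (e + 1) ^ Suc k) * (n + 1) ^ k"
    if v: "independent_mod Q' {..<N} v" "v ` {..<N} \<subseteq> polys_upto d n" for n N v
  proof -
    \<comment> \<open>With n + 1 powers of \<open>f\<close> the family becomes n + 1 times as large,
      while its degree bound plus one is only (n + 1)(e + 1). Dividing by n + 1 lowers the exponent
      by one.\<close>
    obtain w where "independent_mod Q {..<(n + 1) * N} w"
      "w ` {..<(n + 1) * N} \<subseteq> polys_upto d (n + (n + 1) * e)"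
      using independent_mod_powers[OF Q Q' _ f e v] \<open>Q \<subset> Q'\<close> by blast
    from C[OF this] have "(n + 1) * N \<le> C * ((n + 1) * (e + 1)) ^ Suc k"
      by (simp add: algebra_simps)
    also have "\<dots> = (n + 1) * ((C * (e + 1) ^ Suc k) * (n + 1) ^ k)"
      by (simp only: power_mult_distrib power_Suc ac_simps)
    finally show ?thesis by (rule mult_left_le_imp_le) simp
  qed
  then show ?thesis unfolding growth_bounded_def by blast
qed

text \<open>The powers of an element of \<open>Q'\<close> outside \<open>Q\<close> are independent
  modulo \<open>Q\<close>, so the quotient has infinite dimension. They arise from the one-element
  family 1, which is independent modulo the proper ideal \<open>Q'\<close>.\<close>

lemma not_growth_bounded_0:
  assumes Q: "primeideal Q (poly_ring d)" and Q': "primeideal Q' (poly_ring d)" and "Q \<subset> Q'"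
  shows "\<not> growth_bounded d Q 0"
proof
  assume "growth_bounded d Q 0"
  then obtain C :: nat where
    C: "\<And>n (N::nat) v. independent_mod Q {..<N} v \<Longrightarrow> v ` {..<N} \<subseteq> polys_upto d n \<Longrightarrow> N \<le> C"
    unfolding growth_bounded_def power_0 mult_1_right by blast
  have I': "ideal Q' (poly_ring d)" by (rule primeideal.axioms(1)[OF Q'])
  obtain f where f: "f \<in> Q'" "f \<notin> Q" using \<open>Q \<subset> Q'\<close> by blast
  then obtain e where e: "f \<in> polys_upto d e"
    using polys_upto_exists poly_ideal_subset[OF I'] by blast
  have one: "independent_mod Q' {..<1::nat} (\<lambda>_. 1)"
    unfolding independent_mod_def
  proof (intro allI impI ballI)
    fix c :: "nat \<Rightarrow> complex" and i :: nat
    assume c: "(\<Sum>i<1::nat. const_poly (c i) * 1) \<in> Q'" and i: "i \<in> {..<1}"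
    show "c i = 0"
    proof (rule ccontr)
      assume "c i \<noteq> 0"
      have "const_poly (inverse (c i)) * const_poly (c i) \<in> Q'"
        using c i by (intro poly_ideal_const_mult[OF I']) simp
      then show False
        using \<open>c i \<noteq> 0\<close> primeideal_poly_one[OF Q'] by (simp flip: const_poly_mult)
    qed
  qed
  have "(\<lambda>_. 1) ` {..<1::nat} \<subseteq> polys_upto d 0"
    using polys_upto_const[of 1 d 0] by auto
  from independent_mod_powers[OF Q I' _ f e one this, of "Suc C"] \<open>Q \<subset> Q'\<close>
  obtain w where "independent_mod Q {..<Suc C * 1} w" "w ` {..<Suc C * 1} \<subseteq> polys_upto d (0 + Suc C * e)"
    by blast
  from C[OF this] show False by simp
qed

text \<open>Each of the first k strict inclusions lowers the exponent by one; at exponent 0 one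
  further strict inclusion is impossible.\<close>

lemma growth_bounded_prime_chain:
  assumes "growth_bounded d (Q 0) k"
    and "\<And>i. i \<le> Suc k \<Longrightarrow> primeideal (Q i) (poly_ring d)"
    and "\<And>i. i < Suc k \<Longrightarrow> Q i \<subset> Q (Suc i)"
  shows False
  using assms
proof (induction k arbitrary: Q)
  case 0
  then show ?case using not_growth_bounded_0[of "Q 0" d "Q 1"] by simp
next
  case (Suc k)
  have "growth_bounded d (Q 1) k"
    using growth_bounded_Suc[of "Q 0" d "Q 1" k] Suc.prems primeideal.axioms(1)[OF Suc.prems(2)[of 1]]
    by simp
  then show ?case using Suc.IH[of "\<lambda>i. Q (Suc i)"] Suc.prems by simp
qed


subsection \<open>Points of maximal ideals\<close>

definition subst_poly :: "cpoly \<Rightarrow> complex poly \<Rightarrow> cpoly" where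
  "subst_poly x H = poly (map_poly const_poly H) x"

lemma subst_poly_0 [simp]: "subst_poly x 0 = 0"
  by (simp add: subst_poly_def)

lemma subst_poly_pCons [simp]: "subst_poly x (pCons a p) = const_poly a + x * subst_poly x p"
  by (simp add: subst_poly_def map_poly_pCons)

lemma subst_poly_1 [simp]: "subst_poly x 1 = 1"
  by (simp add: one_pCons del: pCons_one)

lemma subst_poly_smult [simp]: "subst_poly x (Polynomial.smult a p) = const_poly a * subst_poly x p"
  by (induction p) (auto simp: const_poly_mult algebra_simps)

lemma subst_poly_add [simp]: "subst_poly x (p + q) = subst_poly x p + subst_poly x q"
proof (induction p arbitrary: q)
  case (pCons a p)
  show ?case
    by (cases q; simp add: pCons.IH const_poly_add distrib_left; simp add: add_ac)
qed simp

lemma subst_poly_mult [simp]: "subst_poly x (p * q) = subst_poly x p * subst_poly x q"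
  by (induction p) (auto simp: algebra_simps)

lemma subst_poly_sum: "subst_poly x (\<Sum>i\<in>A. f i) = (\<Sum>i\<in>A. subst_poly x (f i))"
  by (induction A rule: infinite_finite_induct) auto

lemma subst_poly_prod: "subst_poly x (\<Prod>i\<in>A. f i) = (\<Prod>i\<in>A. subst_poly x (f i))"
  by (induction A rule: infinite_finite_induct) auto

lemma subst_poly_closed: "x \<in> polys d \<Longrightarrow> subst_poly x p \<in> polys d"
proof (induction p)
  case (pCons a p)
  then show ?case
    unfolding subst_poly_pCons by (intro polys_add polys_mult polys_const) auto
qed simp

text \<open>Over \<complex> the polynomial \<open>H\<close> splits off linear factors one at a time,
  and a prime ideal containing the product contains one of the factors; it cannot contain the
  nonzero constant left at the end.\<close>

lemma primeideal_subst_poly: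
  assumes Q: "primeideal Q (poly_ring d)" and x: "x \<in> polys d"
    and "subst_poly x H \<in> Q" "H \<noteq> 0"
  shows "\<exists>a. x - const_poly a \<in> Q"
  using assms(3,4)
proof (induction "degree H" arbitrary: H rule: less_induct)
  case less
  have I: "ideal Q (poly_ring d)" by (rule primeideal.axioms(1)[OF Q])
  show ?case
  proof (cases "degree H = 0")
    case True
    then obtain c where c: "H = [:c:]" by (rule degree_eq_zeroE)
    with less.prems have "const_poly (inverse c) * const_poly c \<in> Q"
      by (intro poly_ideal_const_mult[OF I]) simp
    then show ?thesis
      using less.prems c primeideal_poly_one[OF Q] by (simp flip: const_poly_mult)
  next
    case False
    then obtain a where "poly H a = 0"
      using fundamental_theorem_of_algebra[of H] by (auto simp: constant_degree)
    then obtain H' where H': "H = [:- a, 1:] * H'" by (auto simp: poly_eq_0_iff_dvd)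
    have "(x - const_poly a) * subst_poly x H' \<in> Q"
      using less.prems(1) unfolding H' subst_poly_mult by (simp add: const_poly_uminus)
    then have "x - const_poly a \<in> Q \<or> subst_poly x H' \<in> Q"
      by (rule primeideal_polyD[OF Q _ polys_diff[OF x polys_const] subst_poly_closed[OF x]])
    moreover have "H' \<noteq> 0" using less.prems(2) by (auto simp: H')
    moreover have "degree H' < degree H"
      unfolding H' by (subst degree_mult_eq) (use \<open>H' \<noteq> 0\<close> in auto)
    ultimately show ?thesis using less.hyps by blast
  qed
qed

lemma uncountable_complex: "uncountable (UNIV :: complex set)"
proof
  assume "countable (UNIV :: complex set)"
  then have "countable (range complex_of_real)" by (rule countable_subset[rotated]) simp
  then have "countable (UNIV :: real set)"
    by (rule countable_image_inj_on) (simp add: inj_on_def)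
  then show False using uncountable_UNIV_real by blast
qed

lemma finite_monomials_bounded: "finite {m \<in> monomials d. mdeg m \<le> n}"
proof -
  let ?F = "{f :: nat \<Rightarrow> nat. \<forall>i. (i \<in> {1..d} \<longrightarrow> f i \<in> {..n}) \<and> (i \<notin> {1..d} \<longrightarrow> f i = 0)}"
  have "finite ?F" by (rule finite_set_of_finite_funs) auto
  moreover have "Poly_Mapping.lookup ` {m \<in> monomials d. mdeg m \<le> n} \<subseteq> ?F"
  proof clarify
    fix m i assume m: "m \<in> monomials d" "mdeg m \<le> n"
    have "Poly_Mapping.lookup m i \<le> mdeg m"
      unfolding mdeg_def mweight_def by (cases "i \<in> Poly_Mapping.keys m")
        (auto simp: in_keys_iff intro: member_le_sum[of i _ "Poly_Mapping.lookup m"])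
    with m show "(i \<in> {1..d} \<longrightarrow> Poly_Mapping.lookup m i \<in> {..n}) \<and>
        (i \<notin> {1..d} \<longrightarrow> Poly_Mapping.lookup m i = 0)"
      by (auto simp: monomials_def in_keys_iff subset_iff)
  qed
  ultimately have "finite (Poly_Mapping.lookup ` {m \<in> monomials d. mdeg m \<le> n})"
    by (rule rev_finite_subset)
  then show ?thesis by (rule finite_imageD) (simp add: inj_on_def poly_mapping_eqI)
qed

text \<open>Otherwise the inverses of \<open>x - a\<close> modulo \<open>Q\<close> would form an uncountable
  family in a space of countable dimension, and a linear relation between finitely many of them
  is a polynomial relation for \<open>x\<close>.\<close>

lemma maximal_has_point:
  assumes Q: "primeideal Q (poly_ring d)"
    and inv: "\<And>p. p \<in> polys d \<Longrightarrow> p \<notin> Q \<Longrightarrow> \<exists>q\<in>polys d. 1 - p * q \<in> Q"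
    and x: "x \<in> polys d"
  shows "\<exists>a. x - const_poly a \<in> Q"
proof (rule ccontr)
  assume none: "\<not> ?thesis"
  have I: "ideal Q (poly_ring d)" by (rule primeideal.axioms(1)[OF Q])
  have xa: "x - const_poly a \<in> polys d" for a by (intro polys_diff x polys_const)
  obtain g where g: "\<And>a. g a \<in> polys d" "\<And>a. 1 - (x - const_poly a) * g a \<in> Q"
    using inv[OF xa] none by metis
  obtain n where n: "\<And>a. g a \<in> polys_upto d (n a)" using polys_upto_exists[OF g(1)] by metis
  \<comment> \<open>There are uncountably many \<open>a\<close> but only countably many degree
    bounds, so infinitely many of the inverses \<open>g a\<close> lie in one finite-dimensional
    space.\<close>
  have "\<exists>k. infinite {a. n a = k}"
  proof (rule ccontr)
    assume "\<not> ?thesis"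
    then have "countable (\<Union>k. {a. n a = k})" by (intro countable_UN) (auto intro: countable_finite)
    moreover have "(\<Union>k. {a. n a = k}) = UNIV" by auto
    ultimately show False using uncountable_complex by simp
  qed
  then obtain k where k: "infinite {a. n a = k}" by blast
  let ?B = "{m \<in> monomials d. mdeg m \<le> k}"
  obtain A where A: "A \<subseteq> {a. n a = k}" "finite A" "card A = Suc (card ?B)"
    using infinite_arbitrarily_large[OF k] by blast
  from nontrivial_linear_relation[OF finite_monomials_bounded A(2), of d k "\<lambda>a. Poly_Mapping.lookup (g a)"] A(3)
  obtain c where c: "\<exists>a\<in>A. c a \<noteq> 0"
    "\<And>m. m \<in> ?B \<Longrightarrow> (\<Sum>a\<in>A. c a * Poly_Mapping.lookup (g a) m) = 0" by auto
  have coeff: "Poly_Mapping.lookup (const_poly b * p) m = b * Poly_Mapping.lookup p m" for b p m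
    using lookup_single_mult[of 0 b p m] by (simp add: const_poly_def)
  have zero: "(\<Sum>a\<in>A. const_poly (c a) * g a) = 0"
  proof (rule poly_mapping_eqI)
    fix m
    have "(\<Sum>a\<in>A. c a * Poly_Mapping.lookup (g a) m) = 0"
    proof (cases "m \<in> ?B")
      case False
      then have "m \<notin> Poly_Mapping.keys (g a)" if "a \<in> A" for a
        using n[of a] A(1) that by (auto simp: polys_upto_def)
      then show ?thesis by (intro sum.neutral) (simp add: in_keys_iff)
    qed (rule c(2))
    then show "Poly_Mapping.lookup (\<Sum>a\<in>A. const_poly (c a) * g a) m = Poly_Mapping.lookup 0 m"
      by (simp add: lookup_sum coeff)
  qed
  \<comment> \<open>The relation between the inverses of x - a, for a in \<open>A\<close>, with its
    denominators cleared.\<close>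
  define H where "H = (\<Sum>a\<in>A. Polynomial.smult (c a) (\<Prod>b\<in>A - {a}. [:- b, 1:]))"
  let ?\<pi> = "\<lambda>a. \<Prod>b\<in>A - {a}. (x - const_poly b)"
  have H_eq: "subst_poly x H = (\<Sum>a\<in>A. const_poly (c a) * ?\<pi> a)"
    by (simp add: H_def subst_poly_sum subst_poly_prod const_poly_uminus)
  have \<pi>: "?\<pi> a * (x - const_poly a) = (\<Prod>b\<in>A. (x - const_poly b))" if "a \<in> A" for a
    using prod.remove[OF A(2) that, of "\<lambda>b. x - const_poly b"] by (simp add: mult.commute)
  have "(\<Sum>a\<in>A. const_poly (c a) * (?\<pi> a * (1 - (x - const_poly a) * g a)))
      = (\<Sum>a\<in>A. const_poly (c a) * ?\<pi> a - (\<Prod>b\<in>A. (x - const_poly b)) * (const_poly (c a) * g a))"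
  proof (rule sum.cong[OF refl])
    fix a assume "a \<in> A"
    show "const_poly (c a) * (?\<pi> a * (1 - (x - const_poly a) * g a))
      = const_poly (c a) * ?\<pi> a - (\<Prod>b\<in>A. (x - const_poly b)) * (const_poly (c a) * g a)"
      unfolding \<pi>[OF \<open>a \<in> A\<close>, symmetric] by (simp add: algebra_simps)
  qed
  also have "\<dots> = subst_poly x H"
    using zero by (simp add: sum_subtractf H_eq flip: sum_distrib_left)
  finally have "subst_poly x H = (\<Sum>a\<in>A. const_poly (c a) * (?\<pi> a * (1 - (x - const_poly a) * g a)))"
    by simp
  also have "\<dots> \<in> Q"
  proof (intro poly_ideal_sum[OF I] poly_ideal_const_mult[OF I] poly_ideal_mult[OF I] g(2))
    show "?\<pi> a \<in> polys d" for a
      using subst_poly_closed[OF x, of "\<Prod>b\<in>A - {a}. [:- b, 1:]"]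
      by (simp add: subst_poly_prod const_poly_uminus)
  qed
  finally have "subst_poly x H \<in> Q" .
  moreover have "H \<noteq> 0"
  proof -
    obtain a where a: "a \<in> A" "c a \<noteq> 0" using c(1) by blast
    \<comment> \<open>At a point a with nonzero \<open>c a\<close>, every other summand contains the
      factor a - a.\<close>
    have "poly H a = (\<Sum>a'\<in>A. c a' * (\<Prod>b\<in>A - {a'}. a - b))"
      by (simp add: H_def poly_sum poly_prod)
    also have "\<dots> = c a * (\<Prod>b\<in>A - {a}. a - b)"
      using A(2) a(1) by (subst sum.remove[OF A(2) a(1)]) (auto intro!: sum.neutral)
    also have "\<dots> \<noteq> 0" using A(2) a(2) by auto
    finally show ?thesis by auto
  qed
  ultimately show False using primeideal_subst_poly[OF Q x] none by blast
qed


subsection \<open>The parametrization of the inverse Gaussian cumulant variety\<close>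

definition ig_coeff :: "nat \<Rightarrow> complex" where
  "ig_coeff r = of_nat (\<Prod>i\<in>{1..<r}. 2 * i - 1)"

lemma ig_coeff_nonzero [simp]: "ig_coeff r \<noteq> 0"
  unfolding ig_coeff_def of_nat_eq_0_iff by auto

lemma ig_coeff_1 [simp]: "ig_coeff (Suc 0) = 1"
  by (simp add: ig_coeff_def)

lemma ig_coeff_Suc: "1 \<le> r \<Longrightarrow> ig_coeff (Suc r) = ig_coeff r * of_nat (2 * r - 1)"
  by (simp add: ig_coeff_def)

definition mwt :: "monomial \<Rightarrow> nat" where "mwt = mweight (\<lambda>i. i - 1)"

lemma mwt_simps [simp]:
  "mwt 0 = 0" "mwt (m + m') = mwt m + mwt m'" "mwt (Poly_Mapping.single i k) = k * (i - 1)"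
  by (simp_all add: mwt_def)

abbreviation ig_mcoeff :: "monomial \<Rightarrow> complex" where "ig_mcoeff \<equiv> mvalue ig_coeff"

lemma ig_mcoeff_nonzero [simp]: "ig_mcoeff m \<noteq> 0"
  by (rule mvalue_nonzero) simp

text \<open>The substitution \<open>\<kappa>\<^sub>r \<mapsto> (2r-3)!! s t\<^bsup>r-1\<^esup>\<close>, where \<open>s = \<mu>\<close> is the outer and
  \<open>t = \<mu>\<^sup>2 / \<lambda>\<close> the inner polynomial variable.\<close>

definition ig_map :: "cpoly \<Rightarrow> complex poly poly" where
  "ig_map f = (\<Sum>m\<in>Poly_Mapping.keys f.
     Polynomial.monom (Polynomial.monom (Poly_Mapping.lookup f m * ig_mcoeff m) (mwt m)) (mdeg m))"

lemma ig_map_add: "ig_map (f + g) = ig_map f + ig_map g"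
  unfolding ig_map_def
  by (rule setsum_keys_plus_distrib) (auto simp: add_monom distrib_right)

lemma ig_map_0 [simp]: "ig_map 0 = 0"
  by (simp add: ig_map_def)

lemma ig_map_single [simp]: "ig_map (Poly_Mapping.single m c)
   = Polynomial.monom (Polynomial.monom (c * ig_mcoeff m) (mwt m)) (mdeg m)"
  by (cases "c = 0") (auto simp: ig_map_def)

lemma ig_map_mult: "ig_map (f * g) = ig_map f * ig_map g"
  using subset_UNIV[of "Poly_Mapping.keys f"]
proof (induction f rule: poly_mapping_additive_induct)
  case (single m c)
  show ?case
    using subset_UNIV[of "Poly_Mapping.keys g"]
  proof (induction g rule: poly_mapping_additive_induct)
    case (single m' c')
    show ?case by (simp add: mult_single mult_monom algebra_simps)
  next
    case (add f g)
    then show ?case by (simp add: ig_map_add algebra_simps)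
  qed simp
next
  case (add f g)
  then show ?case by (simp add: ig_map_add algebra_simps)
qed simp

lemma ig_map_uminus: "ig_map (- f) = - ig_map f"
  using ig_map_add[of f "- f"] by (simp add: eq_neg_iff_add_eq_0 add.commute)

lemma ig_map_diff: "ig_map (f - g) = ig_map f - ig_map g"
  using ig_map_add[of f "- g"] by (simp add: ig_map_uminus)

text \<open>The coefficient of \<open_alpha> is read off linearly: with exponents \<alpha> of s and
  \<beta> of t, these functionals turn membership in the kernel of \<open>ig_map\<close> into one
  linear condition per bidegree.\<close>

definition bicoeff :: "nat \<Rightarrow> nat \<Rightarrow> cpoly \<Rightarrow> complex" where
  "bicoeff \<alpha> \<beta> = linear_extension (\<lambda>m. if (mdeg m, mwt m) = (\<alpha>, \<beta>) then ig_mcoeff m else 0)"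

lemma coeff_ig_map: "poly.coeff (poly.coeff (ig_map f) \<alpha>) \<beta> = bicoeff \<alpha> \<beta> f"
  using subset_UNIV[of "Poly_Mapping.keys f"]
  by (induction f rule: poly_mapping_additive_induct)
    (auto simp: bicoeff_def linear_extension_add ig_map_add)

lemma ig_map_eq_0_iff: "ig_map f = 0 \<longleftrightarrow> (\<forall>\<alpha> \<beta>. bicoeff \<alpha> \<beta> f = 0)"
  by (simp add: poly_eq_iff coeff_ig_map)

lemma mvalue_ig_point:
  assumes "m \<in> monomials d"
  shows "mvalue (\<lambda>r\<in>{1..d}. ig_coeff r * s * t ^ (r - 1)) m = ig_mcoeff m * s ^ mdeg m * t ^ mwt m"
proof -
  have "mvalue (\<lambda>r\<in>{1..d}. ig_coeff r * s * t ^ (r - 1)) m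
      = mvalue (\<lambda>r. ig_coeff r * s * t ^ (r - 1)) m"
    unfolding mvalue_def using assms by (intro prod.cong) (auto simp: monomials_def)
  also have "\<dots> = ig_mcoeff m * s ^ mdeg m * t ^ mwt m"
    unfolding mvalue_def mdeg_def mwt_def mweight_def
    by (simp add: power_mult_distrib prod.distrib power_sum mult.commute flip: power_mult)
  finally show ?thesis .
qed

lemma eval_poly_ig_point:
  assumes "f \<in> polys d"
  shows "eval_poly (\<lambda>r\<in>{1..d}. ig_coeff r * s * t ^ (r - 1)) f = poly (poly (ig_map f) [:s:]) t"
  using assms[simplified]
proof (induction f rule: poly_mapping_additive_induct)
  case (single m c)
  show ?case
    unfolding eval_poly_eq linear_extension_single mvalue_ig_point[OF single] ig_map_single
    by (simp add: poly_monom poly_const_pow mult_ac)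
next
  case (add f g)
  then show ?case
    unfolding eval_poly_eq by (simp only: linear_extension_add ig_map_add poly_add)
qed (simp add: eval_poly_eq)

text \<open>Nonzero s and t must suffice, since only these are obtained from parameters with nonzero
  mu. For fixed s there are infinitely many roots t, and then infinitely many constant roots of
  \<open>p\<close> itself.\<close>

lemma poly_poly_eq_0:
  fixes p :: "complex poly poly"
  assumes "\<And>s t. s \<noteq> 0 \<Longrightarrow> t \<noteq> 0 \<Longrightarrow> poly (poly p [:s:]) t = 0"
  shows "p = 0"
proof (rule ccontr)
  assume "p \<noteq> 0"
  have inf: "infinite (UNIV - {0 :: complex})" by (simp add: infinite_UNIV_char_0)
  have "poly p [:s:] = 0" if "s \<noteq> 0" for s
  proof (rule ccontr)
    assume "poly p [:s:] \<noteq> 0"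
    then have "finite {t. poly (poly p [:s:]) t = 0}" by (rule poly_roots_finite)
    then have "finite (UNIV - {0 :: complex})"
      by (rule rev_finite_subset) (use assms that in auto)
    with inf show False by simp
  qed
  then have "(\<lambda>s. [:s:]) ` (UNIV - {0}) \<subseteq> {x. poly p x = 0}" by auto
  moreover have "finite {x. poly p x = 0}" using \<open>p \<noteq> 0\<close> by (rule poly_roots_finite)
  ultimately have "finite ((\<lambda>s. [:s:]) ` (UNIV - {0 :: complex}))" by (rule finite_subset)
  then have "finite (UNIV - {0 :: complex})" by (rule finite_imageD) (simp add: inj_on_def)
  with inf show False by simp
qed

section \<open>The vanishing ideal as the kernel of the parametrization\<close>

lemma vanishing_ideal_zariski_closure:
  assumes "X \<subseteq> affine_space d"
  shows "vanishing_ideal d (zariski_closure d X) = vanishing_ideal d X"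
proof
  show "vanishing_ideal d (zariski_closure d X) \<subseteq> vanishing_ideal d X"
    by (auto simp: vanishing_ideal_def zariski_closure_def)
  show "vanishing_ideal d X \<subseteq> vanishing_ideal d (zariski_closure d X)"
  proof
    fix f assume f: "f \<in> vanishing_ideal d X"
    let ?V = "{x \<in> affine_space d. \<forall>g\<in>{f}. eval_poly x g = 0}"
    have "algebraic_set d ?V"
      unfolding algebraic_set_def using f by (intro exI[of _ "{f}"]) (auto simp: vanishing_ideal_def)
    moreover have "X \<subseteq> ?V" using f assms by (auto simp: vanishing_ideal_def)
    ultimately have "zariski_closure d X \<subseteq> ?V" by (auto simp: zariski_closure_def)
    then show "f \<in> vanishing_ideal d (zariski_closure d X)"
      using f by (auto simp: vanishing_ideal_def)
  qed
qed

definition ig_ideal :: "nat \<Rightarrow> cpoly set" where "ig_ideal d = {f \<in> polys d. ig_map f = 0}"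

lemma ig_ideal_iff [simp]: "f \<in> ig_ideal d \<longleftrightarrow> f \<in> polys d \<and> ig_map f = 0"
  by (simp add: ig_ideal_def)

lemma ig_ideal_subset: "ig_ideal d \<subseteq> polys d"
  by (auto simp: ig_ideal_def)

lemma ig_point_eq:
  assumes "r \<ge> 1" "mu \<noteq> 0"
  shows "ig_cumulant mu lam r = ig_coeff r * mu * (mu\<^sup>2 / lam) ^ (r - 1)"
proof -
  have "2 * r - 1 = 1 + 2 * (r - 1)" using assms by simp
  then have "mu ^ (2 * r - 1) = mu * (mu\<^sup>2) ^ (r - 1)"
    by (simp only: power_add power_mult power_one_right)
  then show ?thesis by (simp add: ig_cumulant_def ig_coeff_def power_divide)
qed

lemma vanishing_ideal_ig: "vanishing_ideal d (ig_cumulant_variety d) = ig_ideal d"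
proof -
  let ?pt = "\<lambda>s t. \<lambda>r\<in>{1..d}. ig_coeff r * s * t ^ (r - 1)"
  let ?X = "{(\<lambda>r\<in>{1..d}. ig_cumulant mu lam r) | mu lam. lam \<noteq> 0}"
  \<comment> \<open>For mu = 0 all cumulants vanish, and s = 0 gives the origin for any t.\<close>
  have pt: "(\<lambda>r\<in>{1..d}. ig_cumulant mu lam r) = ?pt mu (if mu = 0 then 0 else mu\<^sup>2 / lam)" for mu lam
  proof (intro restrict_ext)
    fix r assume "r \<in> {1..d}"
    then show "ig_cumulant mu lam r
        = ig_coeff r * mu * (if mu = 0 then 0 else mu\<^sup>2 / lam) ^ (r - 1)"
      using ig_point_eq[of r mu lam] by (auto simp: ig_cumulant_def)
  qed
  \<comment> \<open>Inverse of the substitution: mu = s and lambda = s^2 / t, which is again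
    nonzero.\<close>
  have mem: "?pt s t \<in> ?X" if "s \<noteq> 0" "t \<noteq> 0" for s t
  proof -
    have "?pt s t = (\<lambda>r\<in>{1..d}. ig_cumulant s (s\<^sup>2 / t) r)"
      unfolding pt using that by simp
    moreover have "s\<^sup>2 / t \<noteq> 0" using that by simp
    ultimately show ?thesis by blast
  qed
  have "?X \<subseteq> affine_space d" by (auto simp: affine_space_def)
  then have "vanishing_ideal d (ig_cumulant_variety d) = vanishing_ideal d ?X"
    unfolding ig_cumulant_variety_def by (rule vanishing_ideal_zariski_closure)
  also have "\<dots> = ig_ideal d"
  proof (intro subset_antisym subsetI)
    fix f assume f: "f \<in> vanishing_ideal d ?X"
    then have fp: "f \<in> polys d" by (simp add: vanishing_ideal_def)
    have "poly (poly (ig_map f) [:s:]) t = 0" if "s \<noteq> 0" "t \<noteq> 0" for s t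
      unfolding eval_poly_ig_point[OF fp, symmetric]
      using f mem[OF that] unfolding vanishing_ideal_def by blast
    then have "ig_map f = 0" by (rule poly_poly_eq_0)
    with fp show "f \<in> ig_ideal d" by simp
  next
    fix f assume f: "f \<in> ig_ideal d"
    then have fp: "f \<in> polys d" by simp
    have 0: "eval_poly (?pt s t) f = 0" for s t
      unfolding eval_poly_ig_point[OF fp] using f by simp
    have "eval_poly x f = 0" if "x \<in> ?X" for x
    proof -
      obtain mu lam where "x = (\<lambda>r\<in>{1..d}. ig_cumulant mu lam r)" using \<open>x \<in> ?X\<close> by blast
      then show ?thesis unfolding pt by (simp only: 0)
    qed
    then show "f \<in> vanishing_ideal d ?X"
      using fp unfolding vanishing_ideal_def by simp
  qed
  finally show ?thesis .
qed

text \<open>Prime because \<open>ig_map\<close> is multiplicative with values in an integral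
  domain.\<close>

lemma primeideal_ig: "primeideal (ig_ideal d) (poly_ring d)"
proof (rule primeidealI)
  show "cring (poly_ring d)" by (rule cring_poly_ring)
  show "ideal (ig_ideal d) (poly_ring d)"
    unfolding poly_ideal_iff using polys_add[of _ d] polys_mult[of _ d]
    by (auto simp: ig_map_add ig_map_mult)
  have "ig_map 1 = 1"
    using ig_map_single[of 0 1] by (simp add: monom_0 pCons_one)
  then have "1 \<notin> ig_ideal d" by simp
  then show "carrier (poly_ring d) \<noteq> ig_ideal d" using polys_const[of 1 d] by auto
  fix f g
  assume "f \<in> carrier (poly_ring d)" "g \<in> carrier (poly_ring d)"
    "f \<otimes>\<^bsub>poly_ring d\<^esub> g \<in> ig_ideal d"
  then show "f \<in> ig_ideal d \<or> g \<in> ig_ideal d" by (auto simp: ig_map_mult)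
qed

lemmas ideal_ig = primeideal.axioms(1)[OF primeideal_ig]


subsection \<open>The minors\<close>

abbreviation pmon :: "nat \<Rightarrow> nat \<Rightarrow> monomial" where
  "pmon i j \<equiv> Poly_Mapping.single i 1 + Poly_Mapping.single j 1"

lemma K_minor_eq: "K_minor i j
    = Poly_Mapping.single (pmon i (j + 1)) (of_nat (2 * i - 1))
      - Poly_Mapping.single (pmon (i + 1) j) (of_nat (2 * j - 1))"
  by (simp add: K_minor_def K_entry_def var_def const_poly_def mult_single mult.assoc add.commute
      del: single_of_nat)

lemma keys_pmon: "Poly_Mapping.keys (pmon i j) = {i, j}"
  by (auto simp: in_keys_iff lookup_add lookup_single when_def split: if_splits)

lemma keys_K_minor:
  assumes "1 \<le> i" "i < j"
  shows "Poly_Mapping.keys (K_minor i j) = {pmon i (j + 1), pmon (i + 1) j}"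
proof -
  have "Poly_Mapping.keys (pmon i (j + 1)) \<noteq> Poly_Mapping.keys (pmon (i + 1) j)"
    unfolding keys_pmon using assms by (simp add: doubleton_eq_iff)
  then have "pmon i (j + 1) \<noteq> pmon (i + 1) j" by metis
  moreover have "of_nat (2 * i - 1) \<noteq> (0::complex)" "of_nat (2 * j - 1) \<noteq> (0::complex)"
    using assms unfolding of_nat_eq_0_iff by auto
  moreover have "Poly_Mapping.keys (Poly_Mapping.single a A - Poly_Mapping.single b B) = {a, b}"
    if "a \<noteq> b" "A \<noteq> 0" "B \<noteq> 0" for a b :: monomial and A B :: complex
    using that by (auto simp: in_keys_iff lookup_minus lookup_single when_def split: if_splits)
  ultimately show ?thesis unfolding K_minor_eq by blast
qed

lemma K_minor_polys:
  assumes "1 \<le> i" "i < j" "j \<le> d - 1"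
  shows "K_minor i j \<in> polys d"
  using assms keys_K_minor[OF assms(1,2)] by auto

lemma K_minors_subset: "K_minors d \<subseteq> polys d"
  unfolding K_minors_def using K_minor_polys by blast

lemma quadric_K_minor:
  assumes "1 \<le> i" "i < j"
  shows "quadric (K_minor i j)"
proof -
  have "K_minor i j \<noteq> 0" using keys_K_minor[OF assms] by auto
  then show ?thesis by (simp add: quadric_def homogeneous_iff keys_K_minor[OF assms])
qed

lemma K_minors_image: "K_minors d = (\<lambda>(j, i). K_minor i j) ` (SIGMA j:{1..d - 1}. {1..<j})"
  unfolding K_minors_def by (auto simp: image_iff) force

text \<open>Different columns give different minors: i is the smallest index of a variable occurring
  in the minor, and j + 1 the largest.\<close>

lemma card_K_minors: "card (K_minors d) = (d - 1) choose 2"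
proof -
  have sum_choose: "(\<Sum>j\<in>{1..n}. j - 1) = n choose 2" for n :: nat
    by (induction n) (auto simp: numeral_2_eq_2)
  have "inj_on (\<lambda>(j, i). K_minor i j) (SIGMA j:{1..d - 1}. {1..<j})"
  proof (rule inj_onI, clarsimp)
    fix i j i' j'
    assume ij: "Suc 0 \<le> i" "i < j" "Suc 0 \<le> i'" "i' < j'" and eq: "K_minor i j = K_minor i' j'"
    have S: "(\<Union>m\<in>Poly_Mapping.keys (K_minor i j). Poly_Mapping.keys m) = {i, i + 1, j, j + 1}"
      if "1 \<le> i" "i < j" for i j
      unfolding keys_K_minor[OF that] using that by (auto simp: keys_pmon simp del: One_nat_def)
    have eqS: "{i, i + 1, j, j + 1} = {i', i' + 1, j', j' + 1}"
      using S[of i j] S[of i' j'] ij eq by simp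
    have "Min {i, i + 1, j, j + 1} = i" "Max {i, i + 1, j, j + 1} = j + 1"
      "Min {i', i' + 1, j', j' + 1} = i'" "Max {i', i' + 1, j', j' + 1} = j' + 1"
      using ij by (auto simp: min_def max_def)
    with eqS show "j = j' \<and> i = i'" by (metis add_right_cancel)
  qed
  then have "card (K_minors d) = card (SIGMA j:{1..d - 1}. {1..<j})"
    unfolding K_minors_image by (rule card_image)
  also have "\<dots> = (\<Sum>j\<in>{1..d - 1}. j - 1)" by simp
  also have "\<dots> = (d - 1) choose 2"
    by (rule sum_choose)
  finally show ?thesis .
qed


subsection \<open>Standard monomials\<close>

text \<open>The quotient of \<beta> by d - 1, rounded up: the least degree of a monomial of weight
  \<beta>, as each variable has weight at most d - 1.\<close>

definition min_deg :: "nat \<Rightarrow> nat \<Rightarrow> nat" where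
  "min_deg d \<beta> = \<beta> div (d - 1) + (if \<beta> mod (d - 1) = 0 then 0 else 1)"

text \<open>With \<beta> = q (d - 1) + r, this is kappa_d^q, times kappa_(r+1) if r is not 0, filled
  up to degree \<alpha> by kappa_1, which has weight 0. The truncated subtraction makes it
  meaningful only if \<open>min_deg d \<beta> \<le> \<alpha>\<close>.\<close>

definition std_monomial :: "nat \<Rightarrow> nat \<Rightarrow> nat \<Rightarrow> monomial" where
  "std_monomial d \<alpha> \<beta> = Poly_Mapping.single 1 (\<alpha> - min_deg d \<beta>)
     + Poly_Mapping.single d (\<beta> div (d - 1))
     + (if \<beta> mod (d - 1) = 0 then 0 else Poly_Mapping.single (\<beta> mod (d - 1) + 1) 1)"

lemma min_deg_le:
  assumes "d \<ge> 2" "\<beta> \<le> (d - 1) * \<alpha>"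
  shows "min_deg d \<beta> \<le> \<alpha>"
proof (cases "\<beta> mod (d - 1) = 0")
  case True
  have "\<beta> div (d - 1) \<le> (d - 1) * \<alpha> div (d - 1)" using assms by (intro div_le_mono)
  with True assms show ?thesis by (simp add: min_deg_def)
next
  case False
  then have "(d - 1) * (\<beta> div (d - 1)) < (d - 1) * \<alpha>"
    using assms mult_div_mod_eq[of "d - 1" \<beta>] by linarith
  with False show ?thesis by (simp add: min_deg_def)
qed

lemma min_deg_add:
  assumes "d \<ge> 2"
  shows "min_deg d (\<beta> + (d - 1)) = min_deg d \<beta> + 1"
proof -
  have "d - 1 \<noteq> 0" using assms by simp
  then show ?thesis unfolding min_deg_def div_add_self2[OF \<open>d - 1 \<noteq> 0\<close>] mod_add_self2 by simp
qed

lemma mwt_le: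
  assumes "m \<in> monomials d"
  shows "mwt m \<le> (d - 1) * mdeg m"
  using mweight_mono[of m "\<lambda>i. i - 1" "\<lambda>_. (d - 1) * 1"] assms
  unfolding mweight_mult mwt_def mdeg_def by (force simp: monomials_def)

lemma min_deg_mwt_le:
  assumes "d \<ge> 2" "m \<in> monomials d"
  shows "min_deg d (mwt m) \<le> mdeg m"
  using min_deg_le mwt_le assms by blast

lemma std_monomial_in:
  assumes "d \<ge> 2"
  shows "std_monomial d \<alpha> \<beta> \<in> monomials d"
proof -
  have "\<beta> mod (d - 1) + 1 \<le> d" using mod_less_divisor[of "d - 1" \<beta>] assms by linarith
  then show ?thesis using assms by (auto simp: std_monomial_def)
qed

lemma mwt_std_monomial:
  assumes "d \<ge> 2"
  shows "mwt (std_monomial d \<alpha> \<beta>) = \<beta>"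
  using div_mult_mod_eq[of \<beta> "d - 1"] by (auto simp: std_monomial_def)

lemma mdeg_std_monomial:
  assumes "min_deg d \<beta> \<le> \<alpha>"
  shows "mdeg (std_monomial d \<alpha> \<beta>) = \<alpha>"
  using assms by (auto simp: std_monomial_def min_deg_def)

lemma monomial_split_off:
  assumes "i \<in> Poly_Mapping.keys (m :: monomial)"
  shows "m = Poly_Mapping.single i 1 + (m - Poly_Mapping.single i 1)"
  using assms by (intro poly_mapping_eqI)
    (auto simp: lookup_add lookup_minus lookup_single when_def in_keys_iff)

lemma monomial_extremal:
  assumes "d \<ge> 2" "m \<in> monomials d" "Poly_Mapping.keys m \<inter> {2..d - 1} = {}"
  shows "m = Poly_Mapping.single 1 (Poly_Mapping.lookup m 1) + Poly_Mapping.single d (Poly_Mapping.lookup m d)"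
proof (rule poly_mapping_eqI)
  fix i
  have "i = 1 \<or> i = d \<or> i \<notin> Poly_Mapping.keys m"
    using assms(2,3) by (fastforce simp: monomials_def)
  then show "Poly_Mapping.lookup m i = Poly_Mapping.lookup (Poly_Mapping.single 1 (Poly_Mapping.lookup m 1)
      + Poly_Mapping.single d (Poly_Mapping.lookup m d)) i"
    using assms(1) by (auto simp: lookup_add lookup_single when_def in_keys_iff)
qed

text \<open>With at most one factor among kappa_2, ..., kappa_(d-1), division of the weight by d - 1
  recovers all exponents, so the monomial is standard. Two such factors form the antidiagonal of a
  minor.\<close>

lemma monomial_cases:
  assumes d: "d \<ge> 2" and m: "m \<in> monomials d"
  obtains (std) "m = std_monomial d (mdeg m) (mwt m)"
  | (reducible) i j u where "1 \<le> i" "i < j" "j \<le> d - 1" "u \<in> monomials d" "m = pmon (i + 1) j + u"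
proof (cases "Poly_Mapping.keys m \<inter> {2..d - 1} = {}")
  case True
  define p q where "p = Poly_Mapping.lookup m 1" and "q = Poly_Mapping.lookup m d"
  have "m = Poly_Mapping.single 1 p + Poly_Mapping.single d q"
    unfolding p_def q_def by (rule monomial_extremal[OF d m True])
  moreover have "q * (d - 1) div (d - 1) = q" using d by simp
  ultimately have "m = std_monomial d (mdeg m) (mwt m)"
    by (simp add: std_monomial_def min_deg_def)
  then show ?thesis by (rule std)
next
  case False
  then obtain a where a: "a \<in> Poly_Mapping.keys m" "2 \<le> a" "a \<le> d - 1" by auto
  define m' where "m' = m - Poly_Mapping.single a 1"
  have m_eq: "m = Poly_Mapping.single a 1 + m'"
    unfolding m'_def by (rule monomial_split_off[OF a(1)])
  then have m': "m' \<in> monomials d" using m monomials_add by metis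
  show ?thesis
  proof (cases "Poly_Mapping.keys m' \<inter> {2..d - 1} = {}")
    case True
    define p q where "p = Poly_Mapping.lookup m' 1" and "q = Poly_Mapping.lookup m' d"
    have "m' = Poly_Mapping.single 1 p + Poly_Mapping.single d q"
      unfolding p_def q_def by (rule monomial_extremal[OF d m' True])
    then have m_eq': "m = Poly_Mapping.single 1 p + Poly_Mapping.single d q + Poly_Mapping.single a 1"
      using m_eq by (simp add: add_ac)
    have wt: "mwt m = (a - 1) + q * (d - 1)" and deg: "mdeg m = p + q + 1"
      unfolding m_eq' by simp_all
    have divmod: "(x + q * n) div n = q" "(x + q * n) mod n = x" if "x < n" for x n :: nat
      using that by simp_all
    have "a - 1 < d - 1" using a by simp
    then have "mwt m div (d - 1) = q" "mwt m mod (d - 1) = a - 1"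
      unfolding wt by (rule divmod)+
    then have "m = std_monomial d (mdeg m) (mwt m)"
      using a deg m_eq' by (simp add: std_monomial_def min_deg_def)
    then show ?thesis by (rule std)
  next
    case False
    then obtain b where b: "b \<in> Poly_Mapping.keys m'" "2 \<le> b" "b \<le> d - 1" by auto
    define u where "u = m' - Poly_Mapping.single b 1"
    have "m' = Poly_Mapping.single b 1 + u"
      unfolding u_def by (rule monomial_split_off[OF b(1)])
    then have "m = pmon a b + u" "m = pmon b a + u" "u \<in> monomials d"
      using m_eq m' monomials_add by (auto simp: add_ac)
    \<comment> \<open>For a <= b the columns are i = a - 1 and j = b; the case a = b is included, as
      i < j still holds.\<close>
    then show ?thesis
      using a b reducible[of "a - 1" b u] reducible[of "b - 1" a u] by (cases "a \<le> b") auto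
  qed
qed

text \<open>The invariant: a reduction step preserves the bidegree and increases the sum of the squares
  of the indices.\<close>

lemma reduction_to_std:
  assumes d: "d \<ge> 2" and m: "m \<in> monomials d"
    and refl: "\<And>m. m \<in> monomials d \<Longrightarrow> R m m"
    and trans: "\<And>m m' m''. R m m' \<Longrightarrow> R m' m'' \<Longrightarrow> R m m''"
    and step: "\<And>i j u. 1 \<le> i \<Longrightarrow> i < j \<Longrightarrow> j \<le> d - 1 \<Longrightarrow> u \<in> monomials d \<Longrightarrow>
      R (pmon i (j + 1) + u) (pmon (i + 1) j + u)"
  shows "R (std_monomial d (mdeg m) (mwt m)) m"
  using m
proof (induction "d\<^sup>2 * mdeg m - mweight (\<lambda>i. i\<^sup>2) m" arbitrary: m rule: less_induct)
  case less
  from d less.prems show ?case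
  proof (cases rule: monomial_cases)
    case std
    then show ?thesis using refl[OF less.prems] by simp
  next
    case (reducible i j u)
    define m' where "m' = pmon i (j + 1) + u"
    have "i \<le> d" "j + 1 \<le> d" using reducible(2,3) d by arith+
    then have m': "m' \<in> monomials d" using reducible by (simp add: m'_def)
    have "mdeg m' = mdeg m" "mwt m' = mwt m"
      using reducible by (simp_all add: m'_def)
    \<comment> \<open>The increase is i^2 + (j + 1)^2 - (i + 1)^2 - j^2 = 2 (j - i).\<close>
    moreover have "mweight (\<lambda>i. i\<^sup>2) m < mweight (\<lambda>i. i\<^sup>2) m'"
      using reducible by (simp add: m'_def power2_eq_square)
    moreover have "mweight (\<lambda>i. i\<^sup>2) m' \<le> d\<^sup>2 * mdeg m'"
      using mweight_mono[of m' "\<lambda>i. i\<^sup>2" "\<lambda>_. d\<^sup>2 * 1"] m'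
      unfolding mweight_mult mdeg_def by (force simp: monomials_def power2_nat_le_eq_le)
    ultimately have "R (std_monomial d (mdeg m) (mwt m)) m'"
      using less.hyps[OF _ m'] by simp
    moreover have "R m' m" using step reducible by (simp add: m'_def)
    ultimately show ?thesis by (rule trans)
  qed
qed


subsection \<open>Generation by the minors\<close>

text \<open>Modulo \<open>J\<close>, each monomial is a multiple \<open>w m\<close> of a
  representative that depends only on its class \<open>b m\<close>. So \<open>f\<close> is congruent
  to a combination of representatives whose coefficients are the sums in
  \<open>zero\<close>.\<close>

lemma normal_form_membership:
  assumes J: "ideal J (poly_ring d)" and f: "f \<in> polys d"
    and nf: "\<And>m. m \<in> monomials d \<Longrightarrow> Poly_Mapping.single m 1 - const_poly (w m) * \<nu> (b m) \<in> J"
    and zero: "\<And>\<beta>. linear_extension (\<lambda>m. if b m = \<beta> then w m else 0) f = 0"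
  shows "f \<in> J"
proof -
  let ?K = "Poly_Mapping.keys f" and ?c = "Poly_Mapping.lookup f"
  have const_sum: "const_poly (sum g A) = (\<Sum>i\<in>A. const_poly (g i))" for g and A :: "monomial set"
    by (induction A rule: infinite_finite_induct) (auto simp: const_poly_add)
  have "(\<Sum>m\<in>?K. const_poly (?c m * w m) * \<nu> (b m))
      = (\<Sum>\<beta>\<in>b ` ?K. \<Sum>m | m \<in> ?K \<and> b m = \<beta>. const_poly (?c m * w m) * \<nu> (b m))"
    by (rule sum.image_gen) simp
  also have "\<dots> = (\<Sum>\<beta>\<in>b ` ?K. const_poly (\<Sum>m | m \<in> ?K \<and> b m = \<beta>. ?c m * w m) * \<nu> \<beta>)"
    by (simp add: const_sum sum_distrib_right)
  also have "\<dots> = 0"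
  proof (intro sum.neutral ballI)
    fix \<beta>
    have "(\<Sum>m | m \<in> ?K \<and> b m = \<beta>. ?c m * w m) = linear_extension (\<lambda>m. if b m = \<beta> then w m else 0) f"
      unfolding linear_extension_def by (intro sum.mono_neutral_cong_left) auto
    then show "const_poly (\<Sum>m | m \<in> ?K \<and> b m = \<beta>. ?c m * w m) * \<nu> \<beta> = 0" using zero by simp
  qed
  finally have 0: "(\<Sum>m\<in>?K. const_poly (?c m * w m) * \<nu> (b m)) = 0" .
  have "f = (\<Sum>m\<in>?K. const_poly (?c m) * Poly_Mapping.single m 1)"
    by (simp add: const_poly_def mult_single flip: poly_mapping_eq_sum_single)
  also have "\<dots> = (\<Sum>m\<in>?K. const_poly (?c m) * (Poly_Mapping.single m 1 - const_poly (w m) * \<nu> (b m)))"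
    using 0 by (simp add: right_diff_distrib sum_subtractf const_poly_mult mult.assoc)
  also have "\<dots> \<in> J"
    using f by (intro poly_ideal_sum[OF J] poly_ideal_const_mult[OF J] nf) auto
  finally show ?thesis .
qed

text \<open>The monomials, scaled so that they are congruent modulo the minors if they have the same bidegree.\<close>

definition nmon :: "monomial \<Rightarrow> cpoly" where
  "nmon m = Poly_Mapping.single m (1 / ig_mcoeff m)"

lemma nmon_polys: "m \<in> monomials d \<Longrightarrow> nmon m \<in> polys d"
  unfolding nmon_def by (rule polys_single)

lemma const_mult_nmon: "const_poly (ig_mcoeff m) * nmon m = Poly_Mapping.single m 1"
  by (simp add: nmon_def const_poly_def mult_single)

text \<open>By \<open>ig_coeff_Suc\<close> the scaling absorbs the factors 2i - 1 and 2j - 1 of the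
  first row of the matrix, so that a minor becomes a pure difference of scaled monomials, as for the
  rational normal curve.\<close>

lemma nmon_minor:
  assumes "1 \<le> i" "i < j"
  shows "nmon (pmon i (j + 1) + u) - nmon (pmon (i + 1) j + u)
    = Poly_Mapping.single u (1 / (ig_coeff i * ig_coeff j * ig_mcoeff u * of_nat (2 * i - 1) * of_nat (2 * j - 1)))
        * K_minor i j"
proof -
  define A B :: complex where "A = of_nat (2 * i - 1)" and "B = of_nat (2 * j - 1)"
  have nz: "A \<noteq> 0" "B \<noteq> 0" unfolding A_def B_def of_nat_eq_0_iff using assms by auto
  have c: "ig_coeff (Suc i) = ig_coeff i * A" "ig_coeff (Suc j) = ig_coeff j * B"
    using assms ig_coeff_Suc[of i, folded A_def] ig_coeff_Suc[of j, folded B_def] by simp_all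
  show ?thesis
    unfolding K_minor_eq nmon_def A_def[symmetric] B_def[symmetric]
    using nz by (simp add: right_diff_distrib mult_single c add_ac field_simps)
qed

lemma K_minors_ideal: "ideal (Idl\<^bsub>poly_ring d\<^esub> (K_minors d)) (poly_ring d)"
  by (rule ideal_genideal_poly[OF K_minors_subset])

lemma nmon_std_congruent:
  assumes "d \<ge> 2" "m \<in> monomials d"
  shows "nmon (std_monomial d (mdeg m) (mwt m)) - nmon m \<in> Idl\<^bsub>poly_ring d\<^esub> (K_minors d)"
proof (rule reduction_to_std[OF assms])
  show "nmon m - nmon m \<in> Idl\<^bsub>poly_ring d\<^esub> (K_minors d)" for m
    using poly_ideal_0[OF K_minors_ideal] by simp
  show "nmon m - nmon m'' \<in> Idl\<^bsub>poly_ring d\<^esub> (K_minors d)"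
    if "nmon m - nmon m' \<in> Idl\<^bsub>poly_ring d\<^esub> (K_minors d)"
      "nmon m' - nmon m'' \<in> Idl\<^bsub>poly_ring d\<^esub> (K_minors d)" for m m' m''
    using poly_ideal_add[OF K_minors_ideal that] by simp
  show "nmon (pmon i (j + 1) + u) - nmon (pmon (i + 1) j + u) \<in> Idl\<^bsub>poly_ring d\<^esub> (K_minors d)"
    if "1 \<le> i" "i < j" "j \<le> d - 1" "u \<in> monomials d" for i j u
    unfolding nmon_minor[OF that(1,2)]
  proof (rule poly_ideal_mult[OF K_minors_ideal])
    show "K_minor i j \<in> Idl\<^bsub>poly_ring d\<^esub> (K_minors d)"
      using genideal_poly_self[OF K_minors_subset] that by (auto simp: K_minors_def)
  qed (rule polys_single[OF that(4)])
qed

lemma ig_map_K_minor: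
  assumes "1 \<le> i" "i < j"
  shows "ig_map (K_minor i j) = 0"
  using assms by (simp add: K_minor_eq ig_map_diff ig_coeff_Suc algebra_simps)

lemma ig_ideal_eq_genideal:
  assumes d: "d \<ge> 2"
  shows "ig_ideal d = Idl\<^bsub>poly_ring d\<^esub> (K_minors d)"
proof
  have "K_minor i j \<in> ig_ideal d" if "1 \<le> i" "i < j" "j \<le> d - 1" for i j
    unfolding ig_ideal_iff using K_minor_polys[OF that] ig_map_K_minor[OF that(1,2)] by blast
  then have "K_minors d \<subseteq> ig_ideal d" unfolding K_minors_def by blast
  then show "Idl\<^bsub>poly_ring d\<^esub> (K_minors d) \<subseteq> ig_ideal d"
    by (rule genideal_poly_minimal[OF ideal_ig])
  show "ig_ideal d \<subseteq> Idl\<^bsub>poly_ring d\<^esub> (K_minors d)"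
  proof
    fix f assume f: "f \<in> ig_ideal d"
    show "f \<in> Idl\<^bsub>poly_ring d\<^esub> (K_minors d)"
    proof (rule normal_form_membership[OF K_minors_ideal,
          where w = ig_mcoeff and b = "\<lambda>m. (mdeg m, mwt m)" and \<nu> = "\<lambda>(\<alpha>, \<beta>). nmon (std_monomial d \<alpha> \<beta>)"])
      show "f \<in> polys d" using f by simp
      show "linear_extension (\<lambda>m. if (mdeg m, mwt m) = \<gamma> then ig_mcoeff m else 0) f = 0" for \<gamma>
        using f by (cases \<gamma>) (simp add: ig_map_eq_0_iff bicoeff_def)
      fix m assume m: "m \<in> monomials d"
      have "const_poly (- ig_mcoeff m) * (nmon (std_monomial d (mdeg m) (mwt m)) - nmon m)
          \<in> Idl\<^bsub>poly_ring d\<^esub> (K_minors d)"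
        by (intro poly_ideal_const_mult[OF K_minors_ideal] nmon_std_congruent d m)
      then show "Poly_Mapping.single m 1 - const_poly (ig_mcoeff m)
          * (case (mdeg m, mwt m) of (\<alpha>, \<beta>) \<Rightarrow> nmon (std_monomial d \<alpha> \<beta>)) \<in> Idl\<^bsub>poly_ring d\<^esub> (K_minors d)"
        unfolding const_mult_nmon[symmetric, of m]
        by (simp add: algebra_simps const_poly_uminus)
    qed
  qed
qed


subsection \<open>Groebner bases\<close>

lemma linear_order_on_finite_max:
  assumes "linear_order_on A r" "finite K" "K \<noteq> {}" "K \<subseteq> A"
  shows "\<exists>m\<in>K. \<forall>m'\<in>K. (m', m) \<in> r"
  using assms(2-4)
proof (induction K rule: finite_ne_induct)
  case (singleton x)
  then show ?case using assms(1) by (auto simp: order_on_defs refl_on_def)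
next
  case (insert x F)
  then obtain m where m: "m \<in> F" "\<forall>m'\<in>F. (m', m) \<in> r" by auto
  have refl: "(x, x) \<in> r" using insert.prems assms(1) by (auto simp: order_on_defs refl_on_def)
  have tr: "trans r" using assms(1) by (simp add: order_on_defs)
  show ?case
  proof (cases "(x, m) \<in> r")
    case True
    then show ?thesis using m by (intro bexI[of _ m]) auto
  next
    case False
    then have "(m, x) \<in> r"
      using m insert.prems refl assms(1) by (auto simp: order_on_defs total_on_def)
    then have "\<forall>m'\<in>F. (m', x) \<in> r" using m(2) tr by (meson transD)
    with refl show ?thesis by (intro bexI[of _ x]) auto
  qed
qed

lemma initial_monomial_max:
  assumes ord: "monomial_order d ord" and f: "f \<in> polys d" "f \<noteq> 0"
  shows "initial_monomial ord f \<in> Poly_Mapping.keys f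
    \<and> (\<forall>m'\<in>Poly_Mapping.keys f. (m', initial_monomial ord f) \<in> ord)"
proof -
  have lin: "linear_order_on (monomials d) ord" using ord by (simp add: monomial_order_def)
  obtain m where m: "m \<in> Poly_Mapping.keys f" "\<forall>m'\<in>Poly_Mapping.keys f. (m', m) \<in> ord"
    using linear_order_on_finite_max[OF lin finite_keys, of f] f by auto
  have anti: "antisym ord" using lin by (simp add: order_on_defs)
  show ?thesis
    unfolding initial_monomial_def
    by (rule theI[of _ m]) (use m anti in \<open>auto dest: antisymD\<close>)
qed

lemma initial_monomial_K_minor:
  assumes "antidiagonal_term_order d ord" "1 \<le> i" "i < j" "j \<le> d - 1"
  shows "initial_monomial ord (K_minor i j) = pmon (i + 1) j"
proof -
  obtain c where c: "c \<noteq> 0" "K_entry 2 i * K_entry 1 j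
      = Poly_Mapping.single (initial_monomial ord (K_minor i j)) c"
    using assms unfolding antidiagonal_term_order_def by blast
  have "K_entry 2 i * K_entry 1 j = Poly_Mapping.single (pmon (i + 1) j) (of_nat (2 * j - 1))"
    by (simp add: K_entry_def var_def const_poly_def mult_single add_ac del: single_of_nat)
  moreover have "of_nat (2 * j - 1) \<noteq> (0::complex)"
    unfolding of_nat_eq_0_iff using assms by simp
  ultimately show ?thesis
    using c arg_cong[of _ _ Poly_Mapping.keys] by (metis keys_single singleton_inject)
qed

text \<open>In each bidegree the standard monomial is the smallest one, so it is not the initial monomial
  of a polynomial whose scaled coefficients sum to zero in that bidegree.\<close>

lemma initial_monomial_ig_ideal:
  assumes d: "d \<ge> 2" and ord: "antidiagonal_term_order d ord" and f: "f \<in> ig_ideal d" "f \<noteq> 0"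
  shows "\<exists>i j u. 1 \<le> i \<and> i < j \<and> j \<le> d - 1 \<and> u \<in> monomials d \<and> initial_monomial ord f = pmon (i + 1) j + u"
proof -
  have mo: "monomial_order d ord" using ord by (simp add: antidiagonal_term_order_def)
  then have lin: "linear_order_on (monomials d) ord" by (simp add: monomial_order_def)
  define m where "m = initial_monomial ord f"
  have m: "m \<in> Poly_Mapping.keys f" "\<And>m'. m' \<in> Poly_Mapping.keys f \<Longrightarrow> (m', m) \<in> ord"
    using initial_monomial_max[OF mo, of f] f by (auto simp: m_def)
  have mm: "m \<in> monomials d" using m(1) f by auto
  \<comment> \<open>Here the relation of \<open>reduction_to_std\<close> is the term order: the
    antidiagonal is the initial monomial of its minor, so every reduction step goes down.\<close>
  have least: "(std_monomial d (mdeg k) (mwt k), k) \<in> ord" if "k \<in> monomials d" for k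
  proof (rule reduction_to_std[OF d that])
    show "(k, k) \<in> ord" if "k \<in> monomials d" for k
      using lin that by (simp add: order_on_defs refl_on_def)
    show "(a, c) \<in> ord" if "(a, b) \<in> ord" "(b, c) \<in> ord" for a b c
      using lin that by (meson order_on_defs transD)
    fix i j u assume ij: "1 \<le> i" "i < j" "j \<le> d - 1" and u: "u \<in> monomials d"
    have "(pmon i (j + 1), initial_monomial ord (K_minor i j)) \<in> ord"
      using initial_monomial_max[OF mo K_minor_polys[OF ij]] quadric_K_minor[OF ij(1,2)]
        keys_K_minor[OF ij(1,2)] by (auto simp: quadric_def)
    then show "(pmon i (j + 1) + u, pmon (i + 1) j + u) \<in> ord"
      using mo u unfolding initial_monomial_K_minor[OF ord ij] monomial_order_def by blast
  qed
  from d mm show ?thesis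
  proof (cases rule: monomial_cases)
    case std
    \<comment> \<open>If \<open>m\<close> were standard, it would be both the largest monomial of
      \<open>f\<close> and the smallest of its bidegree, hence the only one of \<open>f\<close> in
      that bidegree. Its nonzero coefficient would then be the whole sum in
      \<open>bicoeff\<close>.\<close>
    have single: "k = m" if k: "k \<in> Poly_Mapping.keys f" "mdeg k = mdeg m" "mwt k = mwt m" for k
    proof -
      have "k \<in> monomials d" using k f by auto
      from least[OF this] k std have "(m, k) \<in> ord" by simp
      with m(2)[OF k(1)] lin show ?thesis by (auto simp: order_on_defs dest: antisymD)
    qed
    have "bicoeff (mdeg m) (mwt m) f = (\<Sum>k\<in>{m}. Poly_Mapping.lookup f k * ig_mcoeff k)"
      unfolding bicoeff_def linear_extension_def
      by (rule sum.mono_neutral_cong_right) (use m(1) single in auto)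
    moreover have "bicoeff (mdeg m) (mwt m) f = 0" using f(1) by (simp add: ig_map_eq_0_iff)
    ultimately show ?thesis using m(1) by (simp add: in_keys_iff)
  next
    case reducible
    then show ?thesis unfolding m_def by blast
  qed
qed

lemma groebner_basis_K_minors:
  assumes d: "d \<ge> 2" and ord: "antidiagonal_term_order d ord"
  shows "groebner_basis d ord (K_minors d) (ig_ideal d)"
proof -
  let ?in = "\<lambda>f. Poly_Mapping.single (initial_monomial ord f) (1 :: complex)"
  have mo: "monomial_order d ord" using ord by (simp add: antidiagonal_term_order_def)
  have sub: "K_minors d \<subseteq> ig_ideal d"
    unfolding ig_ideal_eq_genideal[OF d] by (rule genideal_poly_self[OF K_minors_subset])
  have in_polys: "?in ` (F - {0}) \<subseteq> polys d" if "F \<subseteq> polys d" for F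
    using initial_monomial_max[OF mo] that by fastforce
  have sub_in: "?in ` (K_minors d - {0}) \<subseteq> ?in ` (ig_ideal d - {0})" using sub by blast
  have idl: "ideal (initial_ideal d ord (K_minors d)) (poly_ring d)"
    unfolding initial_ideal_def by (rule ideal_genideal_poly[OF in_polys[OF K_minors_subset]])
  have "initial_ideal d ord (K_minors d) = initial_ideal d ord (ig_ideal d)"
  proof
    show "initial_ideal d ord (K_minors d) \<subseteq> initial_ideal d ord (ig_ideal d)"
      unfolding initial_ideal_def
    proof (rule genideal_poly_minimal)
      have P: "?in ` (ig_ideal d - {0}) \<subseteq> polys d" by (rule in_polys[OF ig_ideal_subset])
      show "ideal (Idl\<^bsub>poly_ring d\<^esub> (?in ` (ig_ideal d - {0}))) (poly_ring d)"
        by (rule ideal_genideal_poly[OF P])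
      show "?in ` (K_minors d - {0}) \<subseteq> Idl\<^bsub>poly_ring d\<^esub> (?in ` (ig_ideal d - {0}))"
        using sub_in genideal_poly_self[OF P] by (rule subset_trans)
    qed
    have "?in f \<in> initial_ideal d ord (K_minors d)" if f: "f \<in> ig_ideal d" "f \<noteq> 0" for f
    proof -
      obtain i j u where iju: "1 \<le> i" "i < j" "j \<le> d - 1" "u \<in> monomials d"
        "initial_monomial ord f = pmon (i + 1) j + u"
        using initial_monomial_ig_ideal[OF d ord f] by blast
      have "K_minor i j \<in> K_minors d - {0}"
        using iju quadric_K_minor[OF iju(1,2)] by (auto simp: K_minors_def quadric_def)
      then have "?in (K_minor i j) \<in> initial_ideal d ord (K_minors d)"
        unfolding initial_ideal_def using genideal_poly_self[OF in_polys[OF K_minors_subset]] by blast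
      then have "Poly_Mapping.single u 1 * ?in (K_minor i j) \<in> initial_ideal d ord (K_minors d)"
        by (rule poly_ideal_mult[OF idl]) (rule polys_single[OF iju(4)])
      then show ?thesis
        unfolding initial_monomial_K_minor[OF ord iju(1-3)] iju(5)
        by (simp add: mult_single add_ac)
    qed
    then have "?in ` (ig_ideal d - {0}) \<subseteq> initial_ideal d ord (K_minors d)" by blast
    then show "initial_ideal d ord (ig_ideal d) \<subseteq> initial_ideal d ord (K_minors d)"
      unfolding initial_ideal_def[of d ord "ig_ideal d"] by (rule genideal_poly_minimal[OF idl])
  qed
  moreover have "finite (K_minors d)" unfolding K_minors_image by (intro finite_imageI finite_SigmaI) auto
  ultimately show ?thesis using sub by (simp add: groebner_basis_def)
qed


subsection \<open>The Hilbert function\<close>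

lemma bicoeff_linear:
  "bicoeff \<alpha> \<beta> (f + g) = bicoeff \<alpha> \<beta> f + bicoeff \<alpha> \<beta> g"
  "bicoeff \<alpha> \<beta> (f - g) = bicoeff \<alpha> \<beta> f - bicoeff \<alpha> \<beta> g"
  "bicoeff \<alpha> \<beta> (const_poly c * f) = c * bicoeff \<alpha> \<beta> f"
  by (simp_all add: bicoeff_def linear_extension_add linear_extension_diff)

lemma bicoeff_nmon: "bicoeff \<alpha> \<beta> (nmon m) = (if (mdeg m, mwt m) = (\<alpha>, \<beta>) then 1 else 0)"
  by (simp add: bicoeff_def nmon_def)

lemma bicoeff_outside:
  assumes "f \<in> polys d" "(d - 1) * \<alpha> < \<beta>"
  shows "bicoeff \<alpha> \<beta> f = 0"
  unfolding bicoeff_def linear_extension_def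
proof (rule sum.neutral, intro ballI)
  fix m assume "m \<in> Poly_Mapping.keys f"
  then have "mwt m \<le> (d - 1) * mdeg m" using assms(1) by (intro mwt_le) auto
  then have "(mdeg m, mwt m) \<noteq> (\<alpha>, \<beta>)" using assms(2) by auto
  then show "Poly_Mapping.lookup f m * (if (mdeg m, mwt m) = (\<alpha>, \<beta>) then ig_mcoeff m else 0) = 0"
    by (simp only: if_False mult_zero_right)
qed

lemma bicoeff_wrong_degree:
  assumes "homogeneous n f" "\<alpha> \<noteq> n"
  shows "bicoeff \<alpha> \<beta> f = 0"
  unfolding bicoeff_def linear_extension_def
  using assms by (intro sum.neutral) (auto simp: homogeneous_iff)

lemma homogeneous_nmon: "homogeneous (mdeg m) (nmon m)"
  by (auto simp: homogeneous_iff nmon_def)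

text \<open>The images of the spaces \<open>V k\<close> form a flag. It starts at 0, because all
  functionals vanish on \<open>V 0\<close>, and each step adds the line of the standard monomial of
  bidegree (n, k). It ends with all forms of degree n, whose weights are at most (d - 1) n.\<close>

lemma hilbert_function_ig:
  assumes d: "d \<ge> 2"
  shows "hilbert_function d (ig_ideal d) n = (d - 1) * n + 1"
proof -
  let ?S = "poly_ring d" and ?I = "ig_ideal d"
  let ?R = "?S Quot ?I"
  let ?\<pi> = "(+>\<^bsub>?S\<^esub>) ?I"
  interpret I: primeideal ?I ?S by (rule primeideal_ig)
  interpret q: ring_hom_ring ?S ?R ?\<pi> by (rule I.rcos_ring_hom_ring)
  define K where "K = ?\<pi> ` range const_poly"
  have \<pi>_eq: "?\<pi> f = ?\<pi> g \<longleftrightarrow> f - g \<in> ?I" if "f \<in> polys d" "g \<in> polys d" for f g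
    by (rule coset_eq_iff[OF ideal_ig that])
  have \<pi>_add: "?\<pi> (f + g) = ?\<pi> f \<oplus>\<^bsub>?R\<^esub> ?\<pi> g" if "f \<in> polys d" "g \<in> polys d" for f g
    using q.hom_add[of f g] that by simp
  have \<pi>_mult: "?\<pi> (f * g) = ?\<pi> f \<otimes>\<^bsub>?R\<^esub> ?\<pi> g" if "f \<in> polys d" "g \<in> polys d" for f g
    using q.hom_mult[of f g] that by simp
  have \<pi>0: "?\<pi> 0 = \<zero>\<^bsub>?R\<^esub>" using q.hom_zero by simp
  have K: "subfield K ?R"
    unfolding K_def
    using q.img_is_subfield(2)[OF subfield_constants] domain.one_not_zero[OF I.quotient_is_domain] by blast
  define V where "V k = {f \<in> polys d. homogeneous n f \<and> (\<forall>\<beta>\<ge>k. bicoeff n \<beta> f = 0)}" for k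
  define v where "v k = nmon (std_monomial d n k)" for k
  have v: "v k \<in> polys d" "homogeneous n (v k)" "bicoeff n \<beta> (v k) = (if \<beta> = k then 1 else 0)"
    if "k \<le> (d - 1) * n" for k \<beta>
  proof -
    have deg: "mdeg (std_monomial d n k) = n" by (intro mdeg_std_monomial min_deg_le d that)
    show "v k \<in> polys d" unfolding v_def by (intro nmon_polys std_monomial_in d)
    show "homogeneous n (v k)" using homogeneous_nmon[of "std_monomial d n k"] by (simp add: v_def deg)
    show "bicoeff n \<beta> (v k) = (if \<beta> = k then 1 else 0)"
      by (auto simp: v_def bicoeff_nmon deg mwt_std_monomial[OF d])
  qed
  have "q.S.dimension k K (?\<pi> ` V k)" if "k \<le> (d - 1) * n + 1" for k
    using that
  proof (induction k)
    case 0
    have "V 0 \<subseteq> ?I"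
    proof
      fix f assume f: "f \<in> V 0"
      then have "bicoeff \<alpha> \<beta> f = 0" for \<alpha> \<beta>
        using bicoeff_wrong_degree[of n f \<alpha>] by (cases "\<alpha> = n") (auto simp: V_def)
      then show "f \<in> ?I" using f by (simp add: V_def ig_map_eq_0_iff)
    qed
    then have "?\<pi> f = \<zero>\<^bsub>?R\<^esub>" if "f \<in> V 0" for f
      using \<pi>_eq[of f 0] that \<pi>0 by auto
    moreover have "0 \<in> V 0" by (simp add: V_def homogeneous_iff bicoeff_def)
    ultimately have V0: "?\<pi> ` V 0 = {\<zero>\<^bsub>?R\<^esub>}" by auto
    show ?case unfolding V0 by (rule q.S.dimension.zero_dim)
  next
    case (Suc k)
    then have k: "k \<le> (d - 1) * n" by simp
    have v_carrier: "?\<pi> (v k) \<in> carrier ?R" using v(1)[OF k] by simp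
    have "?\<pi> (v k) \<notin> ?\<pi> ` V k"
    proof
      assume "?\<pi> (v k) \<in> ?\<pi> ` V k"
      then obtain f where f: "f \<in> V k" "?\<pi> (v k) = ?\<pi> f" by blast
      then have "v k - f \<in> ?I" using \<pi>_eq[of "v k" f] v(1)[OF k] by (simp add: V_def)
      then have "bicoeff n k (v k - f) = 0" by (simp add: ig_map_eq_0_iff)
      then show False using f(1) v(3)[OF k, of k] by (simp add: bicoeff_linear V_def)
    qed
    moreover have "q.S.line_extension K (?\<pi> (v k)) (?\<pi> ` V k) = ?\<pi> ` V (Suc k)"
    proof (intro subset_antisym subsetI)
      fix u assume "u \<in> q.S.line_extension K (?\<pi> (v k)) (?\<pi> ` V k)"
      then obtain c f where cf: "f \<in> V k" "u = ?\<pi> (const_poly c) \<otimes>\<^bsub>?R\<^esub> ?\<pi> (v k) \<oplus>\<^bsub>?R\<^esub> ?\<pi> f"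
        unfolding q.S.line_extension_mem_iff K_def by blast
      have fp: "f \<in> polys d" using cf(1) by (simp add: V_def)
      have cv: "const_poly c * v k \<in> polys d" by (intro polys_mult polys_const v(1) k)
      have "u = ?\<pi> (const_poly c * v k + f)"
        unfolding cf(2) \<pi>_add[OF cv fp] \<pi>_mult[OF polys_const v(1)[OF k]] ..
      moreover have "const_poly c * v k + f \<in> V (Suc k)"
        using polys_add[OF cv fp] cf(1) v(2,3)[OF k]
        by (auto simp: V_def bicoeff_linear homogeneous_add homogeneous_const_mult)
      ultimately show "u \<in> ?\<pi> ` V (Suc k)" by blast
    next
      fix u assume "u \<in> ?\<pi> ` V (Suc k)"
      then obtain f where f: "f \<in> V (Suc k)" "u = ?\<pi> f" by blast
      define c where "c = bicoeff n k f"
      have fp: "f \<in> polys d" using f by (simp add: V_def)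
      have cv: "const_poly c * v k \<in> polys d" by (intro polys_mult polys_const v(1) k)
      define g where "g = f + const_poly (- c) * v k"
      have gp: "g \<in> polys d"
        unfolding g_def by (intro polys_add fp polys_mult polys_const v(1) k)
      have "bicoeff n \<beta> g = 0" if "\<beta> \<ge> k" for \<beta>
        using f(1) v(3)[OF k, of \<beta>] that by (cases "\<beta> = k") (auto simp: g_def c_def bicoeff_linear V_def)
      moreover have "homogeneous n g"
        unfolding g_def using f(1) v(2)[OF k]
        by (intro homogeneous_add homogeneous_const_mult) (auto simp: V_def)
      ultimately have g: "g \<in> V k" using gp by (simp add: V_def)
      have "f = const_poly c * v k + g" by (simp add: g_def const_poly_uminus)
      then have "u = ?\<pi> (const_poly c) \<otimes>\<^bsub>?R\<^esub> ?\<pi> (v k) \<oplus>\<^bsub>?R\<^esub> ?\<pi> g"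
        using \<pi>_add[OF cv gp] \<pi>_mult[OF polys_const v(1)[OF k]] f(2) by simp
      then show "u \<in> q.S.line_extension K (?\<pi> (v k)) (?\<pi> ` V k)"
        unfolding q.S.line_extension_mem_iff K_def using g by blast
    qed
    ultimately show ?case
      using q.S.dimension.Suc_dim[OF v_carrier _ Suc.IH] k by simp
  qed
  from this[of "(d - 1) * n + 1"]
  have dim: "q.S.dimension ((d - 1) * n + 1) K (?\<pi> ` V ((d - 1) * n + 1))" by simp
  have V: "V ((d - 1) * n + 1) = {p \<in> carrier ?S. homogeneous n p}"
    using bicoeff_outside[of _ d n] by (auto simp: V_def)
  have "q.S.dim K (?\<pi> ` V ((d - 1) * n + 1)) = (d - 1) * n + 1"
    using q.S.dimI[OF K dim] by (simp add: over_def)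
  then show ?thesis
    unfolding hilbert_function_def V K_def by (simp add: image_image)
qed

section \<open>Uniqueness of the Hilbert polynomial, and the degree\<close>

lemma poly_eq_eventually:
  fixes p q :: "rat poly"
  assumes "\<forall>\<^sub>F n in sequentially. poly p (of_nat n) = poly q (of_nat n)"
  shows "p = q"
proof (rule ccontr)
  assume "p \<noteq> q"
  then have fin: "finite {x. poly (p - q) x = 0}" by (intro poly_roots_finite) simp
  obtain N where N: "\<And>n. n \<ge> N \<Longrightarrow> poly p (of_nat n) = poly q (of_nat n)"
    using assms by (auto simp: eventually_sequentially)
  then have "of_nat ` {N..} \<subseteq> {x. poly (p - q) x = 0}" by auto
  then have "finite (of_nat ` {N..} :: rat set)" using fin by (rule finite_subset)
  then have "finite {N..}" by (rule finite_imageD) (simp add: inj_on_def)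
  then show False using infinite_Ici by blast
qed

lemma ideal_degree_ig:
  assumes d: "d \<ge> 2"
  shows "ideal_degree d (ig_ideal d) = of_nat (d - 1)"
proof -
  let ?P = "[:1, of_nat (d - 1):] :: rat poly"
  have P: "of_nat (hilbert_function d (ig_ideal d) n) = poly ?P (of_nat n)" for n
    unfolding hilbert_function_ig[OF d] by simp
  have "hilbert_polynomial d (ig_ideal d) = ?P"
    unfolding hilbert_polynomial_def
  proof (rule the_equality)
    fix Q :: "rat poly"
    assume "\<forall>\<^sub>F n in sequentially. of_nat (hilbert_function d (ig_ideal d) n) = poly Q (of_nat n)"
    then show "Q = ?P" unfolding P by (intro poly_eq_eventually) (simp add: eq_commute)
  qed (simp only: P refl eventually_True)
  then show ?thesis using d by (simp add: ideal_degree_def)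
qed


subsection \<open>Cohen--Macaulayness\<close>

text \<open>Up to degree n only the (n + 1)((d - 1) n + 1) bidegrees in \<open>?B\<close> occur, and
  a polynomial lies in the ideal when its coefficients there vanish. The constant d + 1 is a crude
  bound.\<close>

lemma growth_bounded_ig: "growth_bounded d (ig_ideal d) 2"
  unfolding growth_bounded_def
proof (intro exI[of _ "Suc d"] allI impI)
  fix n N and v :: "nat \<Rightarrow> cpoly"
  assume v: "independent_mod (ig_ideal d) {..<N} v" "v ` {..<N} \<subseteq> polys_upto d n"
  let ?B = "{..n} \<times> {..(d - 1) * n}"
  have "N \<le> card ?B"
  proof (rule independent_mod_card_le[OF v,
        where w = "\<lambda>(\<alpha>, \<beta>) m. if (mdeg m, mwt m) = (\<alpha>, \<beta>) then ig_mcoeff m else 0"])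
    fix p assume p: "p \<in> polys_upto d n"
      and zero: "\<And>b. b \<in> ?B \<Longrightarrow>
        linear_extension (case b of (\<alpha>, \<beta>) \<Rightarrow> \<lambda>m. if (mdeg m, mwt m) = (\<alpha>, \<beta>) then ig_mcoeff m else 0) p = 0"
    have pp: "p \<in> polys d" using p polys_upto_subset by blast
    have "bicoeff \<alpha> \<beta> p = 0" for \<alpha> \<beta>
    proof (cases "(\<alpha>, \<beta>) \<in> ?B")
      case True
      then show ?thesis using zero[OF True] by (simp add: bicoeff_def)
    next
      case False
      show ?thesis
      proof (cases "\<alpha> \<le> n")
        case True
        have "(d - 1) * \<alpha> \<le> (d - 1) * n" using True by simp
        moreover have "\<not> \<beta> \<le> (d - 1) * n" using False True by simp
        ultimately have "(d - 1) * \<alpha> < \<beta>" by linarith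
        then show ?thesis by (rule bicoeff_outside[OF pp])
      next
        case False
        then show ?thesis
          unfolding bicoeff_def linear_extension_def using p
          by (intro sum.neutral) (auto simp: polys_upto_def)
      qed
    qed
    with pp show "p \<in> ig_ideal d" by (simp add: ig_map_eq_0_iff)
  qed simp
  also have "card ?B = (n + 1) * ((d - 1) * n + 1)" by simp
  also have "\<dots> \<le> (n + 1) * (Suc d * (n + 1))"
  proof (rule mult_le_mono2)
    have "x \<le> d * n \<Longrightarrow> x + 1 \<le> Suc d * (n + 1)" for x by simp
    then show "(d - 1) * n + 1 \<le> Suc d * (n + 1)" by (simp only: mult_le_mono1 diff_le_self)
  qed
  also have "\<dots> = Suc d * (n + 1)\<^sup>2" by (simp add: power2_eq_square algebra_simps)
  finally show "N \<le> Suc d * (n + 1)\<^sup>2" .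
qed

text \<open>The coefficients of the normal form modulo \<open>\<kappa>\<^sub>1 - a\<close> and the minors.\<close>

definition slice_coeff :: "nat \<Rightarrow> complex \<Rightarrow> nat \<Rightarrow> cpoly \<Rightarrow> complex" where
  "slice_coeff d a \<beta> = linear_extension
     (\<lambda>m. if mwt m = \<beta> then ig_mcoeff m * a ^ (mdeg m - min_deg d \<beta>) else 0)"

text \<open>Multiplication by a monomial shifts the weight and multiplies by a scalar. The exponents
  of \<open>a\<close> add up because every truncated subtraction involved is a true one.\<close>

lemma slice_coeff_shift:
  assumes d: "d \<ge> 2" and u: "u \<in> monomials d" and g: "g \<in> polys d"
  shows "slice_coeff d a \<beta> (Poly_Mapping.single u c * g) = (if mwt u \<le> \<beta>
    then c * ig_mcoeff u * a ^ (mdeg u + min_deg d (\<beta> - mwt u) - min_deg d \<beta>)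
      * slice_coeff d a (\<beta> - mwt u) g else 0)"
proof (cases "mwt u \<le> \<beta>")
  case False
  then show ?thesis
    unfolding slice_coeff_def linear_extension_single_mult
    by (simp add: linear_extension_def)
next
  case True
  define \<beta>' where "\<beta>' = \<beta> - mwt u"
  have \<beta>: "\<beta> = mwt u + \<beta>'" using True by (simp add: \<beta>'_def)
  \<comment> \<open>A monomial of weight \<beta>' and least degree. Its product with
    \<open>u\<close> has weight \<beta>, hence degree at least \<open>min_deg d \<beta>\<close>,
    which gives the inequality \<open>sub\<close>.\<close>
  let ?s = "std_monomial d (min_deg d \<beta>') \<beta>'"
  have "min_deg d (mwt (u + ?s)) \<le> mdeg (u + ?s)"
    by (intro min_deg_mwt_le d) (use u std_monomial_in[OF d] in simp)
  then have sub: "min_deg d \<beta> \<le> mdeg u + min_deg d \<beta>'"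
    by (simp add: mdeg_std_monomial mwt_std_monomial[OF d] \<beta>)
  let ?k = "ig_mcoeff u * a ^ (mdeg u + min_deg d \<beta>' - min_deg d \<beta>)"
  have "linear_extension (\<lambda>m. if mwt (u + m) = \<beta> then ig_mcoeff (u + m) * a ^ (mdeg (u + m) - min_deg d \<beta>) else 0) g
    = linear_extension (\<lambda>m. ?k * (if mwt m = \<beta>' then ig_mcoeff m * a ^ (mdeg m - min_deg d \<beta>') else 0)) g"
  proof (rule linear_extension_cong)
    fix m assume "m \<in> Poly_Mapping.keys g"
    then have m: "m \<in> monomials d" using g by auto
    show "(if mwt (u + m) = \<beta> then ig_mcoeff (u + m) * a ^ (mdeg (u + m) - min_deg d \<beta>) else 0)
      = ?k * (if mwt m = \<beta>' then ig_mcoeff m * a ^ (mdeg m - min_deg d \<beta>') else 0)"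
    proof (cases "mwt m = \<beta>'")
      case True
      have "min_deg d \<beta>' \<le> mdeg m" using min_deg_mwt_le[OF d m] True by simp
      then have "mdeg (u + m) - min_deg d \<beta>
          = (mdeg u + min_deg d \<beta>' - min_deg d \<beta>) + (mdeg m - min_deg d \<beta>')"
        using sub by simp
      then show ?thesis using True by (simp add: \<beta> power_add)
    qed (simp add: \<beta>)
  qed
  then show ?thesis
    unfolding slice_coeff_def linear_extension_single_mult linear_extension_scale \<beta>'_def[symmetric]
    using True by (simp add: mult.assoc)
qed

lemma slice_coeff_diff: "slice_coeff d a \<beta> (f - g) = slice_coeff d a \<beta> f - slice_coeff d a \<beta> g"
  by (simp add: slice_coeff_def linear_extension_diff)

lemma slice_coeff_const_mult: "slice_coeff d a \<beta> (const_poly c * f) = c * slice_coeff d a \<beta> f"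
  by (simp add: slice_coeff_def)

lemma slice_kernel_ideal:
  assumes d: "d \<ge> 2"
  shows "ideal {g \<in> polys d. \<forall>\<beta>. slice_coeff d a \<beta> g = 0} (poly_ring d)"
  unfolding poly_ideal_iff
proof (intro conjI ballI)
  fix g r assume g: "g \<in> {g \<in> polys d. \<forall>\<beta>. slice_coeff d a \<beta> g = 0}" and r: "r \<in> polys d"
  have "slice_coeff d a \<beta> (r * g) = 0" for \<beta>
    using r[simplified]
  proof (induction r rule: poly_mapping_additive_induct)
    case (single m c)
    then show ?case using slice_coeff_shift[OF d single, of g a \<beta> c] g by simp
  qed (auto simp: slice_coeff_def distrib_right linear_extension_add)
  then show "r * g \<in> {g \<in> polys d. \<forall>\<beta>. slice_coeff d a \<beta> g = 0}"
    using polys_mult[OF r, of g] g by simp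
qed (use polys_add[of _ d] in \<open>auto simp: slice_coeff_def linear_extension_add\<close>)

lemma std_monomial_min_deg:
  "std_monomial d \<alpha> \<beta> = Poly_Mapping.single 1 (\<alpha> - min_deg d \<beta>) + std_monomial d (min_deg d \<beta>) \<beta>"
  by (simp add: std_monomial_def add.assoc)

text \<open>Setting kappa_1 = a leaves one standard monomial for each weight, the one of least
  degree, and \<open>slice_coeff\<close> reads off its coefficient. As the common kernel is an
  ideal, the first inclusion is checked on generators.\<close>

lemma slice_ideal_eq:
  assumes d: "d \<ge> 2"
  shows "Idl\<^bsub>poly_ring d\<^esub> (ig_ideal d \<union> {var 1 - const_poly a})
    = {g \<in> polys d. \<forall>\<beta>. slice_coeff d a \<beta> g = 0}" (is "?J = ?N")
proof
  have v1: "var 1 - const_poly a \<in> polys d"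
    using d by (intro polys_diff polys_var polys_const) simp
  have gens: "ig_ideal d \<union> {var 1 - const_poly a} \<subseteq> polys d" using v1 by auto
  note J = ideal_genideal_poly[OF gens]
  have gensJ: "ig_ideal d \<union> {var 1 - const_poly a} \<subseteq> ?J" by (rule genideal_poly_self[OF gens])
  show "?J \<subseteq> ?N"
  proof (rule genideal_poly_minimal[OF slice_kernel_ideal[OF d]])
    have "K_minor i j \<in> ?N" if ij: "1 \<le> i" "i < j" "j \<le> d - 1" for i j
    proof -
      have "slice_coeff d a \<beta> (K_minor i j) = 0" for \<beta>
        using ij(1,2) by (simp add: K_minor_eq slice_coeff_def linear_extension_diff ig_coeff_Suc mult_ac)
      then show ?thesis using K_minor_polys[OF ij] by simp
    qed
    then have "ig_ideal d \<subseteq> ?N"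
      unfolding ig_ideal_eq_genideal[OF d]
      by (intro genideal_poly_minimal[OF slice_kernel_ideal[OF d]]) (auto simp: K_minors_def)
    moreover have "slice_coeff d a \<beta> (var 1 - const_poly a) = 0" for \<beta>
      by (auto simp: slice_coeff_def linear_extension_diff var_def const_poly_def min_deg_def)
    ultimately show "ig_ideal d \<union> {var 1 - const_poly a} \<subseteq> ?N" using v1 by blast
  qed
  show "?N \<subseteq> ?J"
  proof
    fix g assume g: "g \<in> ?N"
    let ?w = "\<lambda>m. ig_mcoeff m * a ^ (mdeg m - min_deg d (mwt m))"
    let ?\<nu> = "\<lambda>\<beta>. nmon (std_monomial d (min_deg d \<beta>) \<beta>)"
    show "g \<in> ?J"
    proof (rule normal_form_membership[OF J, where w = ?w and b = mwt and \<nu> = ?\<nu>])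
      show "g \<in> polys d" using g by simp
      have "linear_extension (\<lambda>m. if mwt m = \<beta> then ?w m else 0) g = slice_coeff d a \<beta> g" for \<beta>
        unfolding slice_coeff_def by (rule linear_extension_cong) auto
      then show "linear_extension (\<lambda>m. if mwt m = \<beta> then ?w m else 0) g = 0" for \<beta>
        using g by simp
      fix m assume m: "m \<in> monomials d"
      define k where "k = mdeg m - min_deg d (mwt m)"
      let ?s = "std_monomial d (mdeg m) (mwt m)" and ?n = "?\<nu> (mwt m)"
      \<comment> \<open>No scalar appears, since \<open>ig_coeff\<close> is 1 at index 1.\<close>
      have s: "nmon ?s = var 1 ^ k * ?n"
        by (subst std_monomial_min_deg) (simp add: nmon_def var_power mult_single k_def)
      have n: "?n \<in> polys d" by (intro nmon_polys std_monomial_in d)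
      have "nmon ?s - nmon m \<in> ig_ideal d"
        unfolding ig_ideal_eq_genideal[OF d] by (rule nmon_std_congruent[OF d m])
      then have "0 - (nmon ?s - nmon m) \<in> ig_ideal d"
        by (rule poly_ideal_diff[OF ideal_ig poly_ideal_0[OF ideal_ig]])
      then have "nmon m - nmon ?s \<in> ig_ideal d" by (simp only: diff_0 minus_diff_eq)
      then have 1: "nmon m - nmon ?s \<in> ?J" using gensJ by blast
      have pow: "var 1 ^ k - const_poly a ^ k \<in> ?J" for k
      proof (induction k)
        case 0
        then show ?case using poly_ideal_0[OF J] by simp
      next
        case (Suc k)
        have "var 1 ^ k * (var 1 - const_poly a) + const_poly a * (var 1 ^ k - const_poly a ^ k) \<in> ?J"
          using gensJ d
          by (intro poly_ideal_add[OF J] poly_ideal_const_mult[OF J Suc] poly_ideal_mult[OF J]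
              polys_power polys_var) auto
        then show ?case by (simp add: algebra_simps)
      qed
      have "const_poly (ig_mcoeff m) * ((nmon m - nmon ?s) + ?n * (var 1 ^ k - const_poly a ^ k)) \<in> ?J"
        by (intro poly_ideal_const_mult[OF J] poly_ideal_add[OF J] 1 poly_ideal_mult[OF J] pow n)
      then show "Poly_Mapping.single m 1 - const_poly (?w m) * ?n \<in> ?J"
        unfolding const_mult_nmon[symmetric, of m] s k_def[symmetric]
        by (simp add: algebra_simps const_poly_mult const_poly_power)
    qed
  qed
qed

text \<open>Multiplication by kappa_d shifts the weight by d - 1 with the nonzero factor
  \<open>ig_coeff d\<close> and, by \<open>min_deg_add\<close>, without a power of \<open>a\<close>.
  The assumption becomes a recursion for the coefficients of \<open>g\<close> that has only the zero
  solution.\<close>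

lemma slice_regular:
  assumes d: "d \<ge> 2" and g: "g \<in> polys d"
    and mem: "(var d - const_poly b) * g \<in> Idl\<^bsub>poly_ring d\<^esub> (ig_ideal d \<union> {var 1 - const_poly a})"
  shows "g \<in> Idl\<^bsub>poly_ring d\<^esub> (ig_ideal d \<union> {var 1 - const_poly a})"
proof -
  let ?L = "\<lambda>\<beta>. slice_coeff d a \<beta> g"
  have shift: "slice_coeff d a \<beta> (var d * g) = (if d - 1 \<le> \<beta> then ig_coeff d * ?L (\<beta> - (d - 1)) else 0)" for \<beta>
  proof -
    have "min_deg d \<beta> = min_deg d (\<beta> - (d - 1)) + 1" if "d - 1 \<le> \<beta>"
      using min_deg_add[OF d, of "\<beta> - (d - 1)"] that by simp
    then show ?thesis
      unfolding var_def using d by (subst slice_coeff_shift[OF d _ g]) auto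
  qed
  have rec: "b * ?L \<beta> = (if d - 1 \<le> \<beta> then ig_coeff d * ?L (\<beta> - (d - 1)) else 0)" for \<beta>
  proof -
    have "slice_coeff d a \<beta> (var d * g - const_poly b * g) = 0"
      using mem unfolding slice_ideal_eq[OF d] by (simp add: left_diff_distrib)
    then show ?thesis unfolding slice_coeff_diff shift slice_coeff_const_mult by simp
  qed
  have "?L \<beta> = 0" for \<beta>
  proof (cases "b = 0")
    \<comment> \<open>For b = 0 the recursion at weight \<beta> + (d - 1) gives the coefficient at
      \<beta>; otherwise induction on the weight applies.\<close>
    case True
    then show ?thesis using rec[of "\<beta> + (d - 1)"] by simp
  next
    case False
    show ?thesis
    proof (induction \<beta> rule: less_induct)
      case (less \<beta>)
      have "?L (\<beta> - (d - 1)) = 0" if "d - 1 \<le> \<beta>" using less[of "\<beta> - (d - 1)"] that d by simp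
      then show ?case using rec[of \<beta>] False by (simp split: if_splits)
    qed
  qed
  then show ?thesis unfolding slice_ideal_eq[OF d] using g by simp
qed

lemma cohen_macaulay_ig:
  assumes d: "d \<ge> 2"
  shows "cohen_macaulay_ideal (poly_ring d) (ig_ideal d)"
proof -
  let ?S = "poly_ring d" and ?I = "ig_ideal d"
  let ?R = "?S Quot ?I"
  let ?\<pi> = "(+>\<^bsub>?S\<^esub>) ?I"
  interpret I: primeideal ?I ?S by (rule primeideal_ig)
  interpret q: ring_hom_ring ?S ?R ?\<pi> by (rule I.rcos_ring_hom_ring)
  have cS: "cring ?S" by (rule cring_poly_ring)
  have cR: "cring ?R" by (rule I.quotient_is_cring[OF cS])
  have surj: "carrier ?R = ?\<pi> ` carrier ?S" by (rule I.quot_carrier)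
  \<comment> \<open>Prime chains and maximal ideals of the quotient are pulled back, so that the
    growth bound and the search for a point take place among polynomials.\<close>
  let ?pre = "\<lambda>P. {f \<in> carrier ?S. ?\<pi> f \<in> P}"
  have pre_prime: "primeideal (?pre P) ?S" if "primeideal P ?R" for P
    by (rule q.primeideal_vimage[OF cS that])
  have pre_I: "?I \<subseteq> ?pre P" if "ideal P ?R" for P
  proof
    fix f assume f: "f \<in> ?I"
    have "?\<pi> f = \<zero>\<^bsub>?R\<^esub>" unfolding zero_FactRing by (rule I.a_rcos_const[OF f])
    then have "?\<pi> f \<in> P" using additive_subgroup.zero_closed[OF ideal.axioms(1)[OF that]] by metis
    then show "f \<in> ?pre P" using f by simp
  qed
  have "cohen_macaulay_ring ?R"
  proof (rule cohen_macaulay_ringI[where n = 2, OF cR noetherian_ring.noetherian_quot[OF noetherian_poly_ring ideal_ig]])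
    fix P assume P: "maximalideal P ?R"
    have PI: "ideal P ?R" by (rule maximalideal.axioms(1)[OF P])
    let ?Q = "?pre P"
    have Q: "primeideal ?Q ?S"
      by (rule pre_prime[OF cring.maximalideal_prime[OF cR P]])
    have inv: "\<exists>g\<in>polys d. 1 - f * g \<in> ?Q" if f: "f \<in> polys d" "f \<notin> ?Q" for f
    proof -
      obtain y p where y: "y \<in> carrier ?R" "p \<in> P" "\<one>\<^bsub>?R\<^esub> = p \<oplus>\<^bsub>?R\<^esub> ?\<pi> f \<otimes>\<^bsub>?R\<^esub> y"
        using cring.maximalideal_invertible[OF cR P, of "?\<pi> f"] f surj by auto
      then obtain g where g: "g \<in> polys d" "y = ?\<pi> g" using surj by auto
      have "p \<in> carrier ?R" using y(2) by (rule ideal.Icarr[OF PI])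
      then obtain h where h: "h \<in> polys d" "p = ?\<pi> h" using surj by auto
      have fg: "f * g \<in> polys d" by (rule polys_mult[OF f(1) g(1)])
      have "?\<pi> 1 = ?\<pi> (h + f * g)"
        using q.hom_one q.hom_add[of h "f * g"] q.hom_mult[of f g] y(3) f(1) g h fg by simp
      then have "1 - (h + f * g) \<in> ?I"
        using coset_eq_iff[OF ideal_ig _ polys_add[OF h(1) fg], of 1] by simp
      then have "1 - (h + f * g) \<in> ?Q" using pre_I[OF PI] by blast
      moreover have "h \<in> ?Q" using h y(2) by simp
      ultimately have "(1 - (h + f * g)) + h \<in> ?Q" by (rule poly_ideal_add[OF primeideal.axioms(1)[OF Q]])
      then have "1 - f * g \<in> ?Q" by (simp only: diff_add_eq_diff_diff_swap diff_add_cancel)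
      then show ?thesis using g(1) by blast
    qed
    have v1: "var 1 \<in> polys d" and vd: "var d \<in> polys d" using polys_var[of 1 d] polys_var[of d d] d by auto
    obtain a where a: "var 1 - const_poly a \<in> ?Q" using maximal_has_point[OF Q inv v1] by blast
    obtain b where b: "var d - const_poly b \<in> ?Q" using maximal_has_point[OF Q inv vd] by blast
    let ?f = "var 1 - const_poly a" and ?g = "var d - const_poly b"
    have fg: "?f \<in> polys d" "?g \<in> polys d" using a b by simp_all
    have "regular_sequence ?R (map ?\<pi> [?f, ?g])"
    proof (rule cring.regular_sequence_quotI[OF cS ideal_ig])
      show "set [?f, ?g] \<subseteq> carrier ?S" using fg by simp
      have "Idl\<^bsub>?S\<^esub> (?I \<union> set [?f, ?g]) \<subseteq> ?Q"
        using pre_I[OF PI] a b by (intro genideal_poly_minimal primeideal.axioms(1)[OF Q]) auto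
      then show "Idl\<^bsub>?S\<^esub> (?I \<union> set [?f, ?g]) \<noteq> carrier ?S"
        using primeideal.I_notcarr[OF Q] by blast
      fix i r assume i: "i < length [?f, ?g]" and r: "r \<in> carrier ?S"
        and mem: "[?f, ?g] ! i \<otimes>\<^bsub>?S\<^esub> r \<in> Idl\<^bsub>?S\<^esub> (?I \<union> set (take i [?f, ?g]))"
      have "i = 0 \<or> i = 1" using i by auto
      then show "r \<in> Idl\<^bsub>?S\<^esub> (?I \<union> set (take i [?f, ?g]))"
      proof
        assume "i = 0"
        have Idl_I: "Idl\<^bsub>?S\<^esub> ?I = ?I"
          by (intro subset_antisym genideal_poly_minimal[OF ideal_ig] genideal_poly_self order_refl
              ig_ideal_subset)
        \<comment> \<open>The coefficient of s in the image of kappa_1 - a is 1, so this element is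
          not in the prime ideal and is regular modulo it.\<close>
        have "bicoeff 1 0 ?f = 1"
          by (simp add: bicoeff_def linear_extension_diff var_def const_poly_def)
        then have "?f \<notin> ?I" using ig_map_eq_0_iff[of ?f] by force
        moreover have "?f * r \<in> ?I" using mem \<open>i = 0\<close> Idl_I by simp
        ultimately have "r \<in> ?I"
          using primeideal_polyD[OF primeideal_ig, of ?f r] fg(1) r by auto
        then show ?thesis using \<open>i = 0\<close> Idl_I by simp
      next
        assume "i = 1"
        then show ?thesis using slice_regular[OF d, of r b a] mem r by simp
      qed
    qed
    moreover have "set (map ?\<pi> [?f, ?g]) \<subseteq> P" using a b by simp
    ultimately show "\<exists>xs. length xs = 2 \<and> regular_sequence ?R xs \<and> set xs \<subseteq> P"
      by (intro exI[of _ "map ?\<pi> [?f, ?g]"]) simp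
  next
    fix P :: "nat \<Rightarrow> cpoly set set"
    assume prime: "\<And>i. i \<le> Suc 2 \<Longrightarrow> primeideal (P i) ?R"
      and chain: "\<And>i. i < Suc 2 \<Longrightarrow> P i \<subset> P (Suc i)"
    have "growth_bounded d (?pre (P 0)) 2"
      using growth_bounded_ig pre_I[OF primeideal.axioms(1)[OF prime[of 0]]] growth_bounded_mono by blast
    then show False
    proof (rule growth_bounded_prime_chain[where Q = "\<lambda>i. ?pre (P i)" and k = 2])
      fix i :: nat
      show "primeideal (?pre (P i)) ?S" if "i \<le> Suc 2" by (rule pre_prime[OF prime[OF that]])
      assume i: "i < Suc 2"
      \<comment> \<open>Surjectivity of the projection keeps the inclusions strict after pulling
        back.\<close>
      obtain x where x: "x \<in> P (Suc i)" "x \<notin> P i" using chain[OF i] by blast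
      then have "x \<in> carrier ?R"
        using ideal.Icarr[OF primeideal.axioms(1)[OF prime[of "Suc i"]]] i by simp
      then obtain f where "f \<in> carrier ?S" "x = ?\<pi> f" using surj by blast
      with x chain[OF i] show "?pre (P i) \<subset> ?pre (P (Suc i))" by blast
    qed
  qed
  then show ?thesis using ideal_ig by (simp add: cohen_macaulay_ideal_def)
qed

theorem proposition3p8:
  fixes d :: nat
  assumes "d \<ge> 2"
  shows "primeideal (vanishing_ideal d (ig_cumulant_variety d)) (poly_ring d)
    \<and> vanishing_ideal d (ig_cumulant_variety d) = Idl\<^bsub>poly_ring d\<^esub> (K_minors d)
    \<and> card (K_minors d) = (d - 1) choose 2
    \<and> (\<forall>f \<in> K_minors d. quadric f)
    \<and> cohen_macaulay_ideal (poly_ring d) (vanishing_ideal d (ig_cumulant_variety d))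
    \<and> ideal_degree d (vanishing_ideal d (ig_cumulant_variety d)) = of_nat (d - 1)
    \<and> (\<forall>ord. antidiagonal_term_order d ord \<longrightarrow>
         groebner_basis d ord (K_minors d) (vanishing_ideal d (ig_cumulant_variety d)))"
proof -
  have "\<forall>f \<in> K_minors d. quadric f"
    using quadric_K_minor by (auto simp: K_minors_def)
  then show ?thesis
    unfolding vanishing_ideal_ig
    using primeideal_ig ig_ideal_eq_genideal[OF assms] card_K_minors cohen_macaulay_ig[OF assms]
      ideal_degree_ig[OF assms] groebner_basis_K_minors[OF assms] by blast
qed

end
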